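(* Let $\|\cdot\|$ be an $\mathrm{Ad}$-invariant Finsler norm on $\mathfrak{u}_n$. Let $X,V\in\mathfrak{u}_n$, write $V=i\sum_{k} v_kP_k$ with $v_1>v_2>\dots$ the distinct eigenvalues of $-iV$ and $P_k$ the orthogonal projections onto the corresponding eigenspaces, and let $\varphi=(N|\,\cdot\,)$, $N\in\mathfrak{u}_n$, be any norming functional for $V$. Let $X_C$ be the block-codiagonal part of $X$ with respect to $V$. Then $$\varphi([X,[X,V]])=0\quad\text{if and only if}\quad [X_C,N]=0.$$ Moreover, if $\varphi([X,[X,V]])=0$, then: (a) if $N$ is diagonal with respect to $V$ (in particular, if $\varphi$ is the unique norming functional for $V$), then $[X,N]=0$; (b) if $F_\varphi=\{V\}$, then $[X,V]=0$.
   Context: $\mathfrak{u}_n$ is the real vector space of $n\times n$ complex skew-Hermitian matrices, $\mathbf{U}_n$ the group of $n\times n$ unitary matrices, $[A,B]=AB-BA$. An $\mathrm{Ad}$-invariant Finsler norm on $\mathfrak{u}_n$ is a function $\|\cdot\|:\mathfrak{u}_n\to\mathbb{R}_{\ge 0}$ such that for all $X,Y\in\mathfrak{u}_n$: $\|X\|=0$ iff $X=0$; $\|X+Y\|\le\|X\|+\|Y\|$; $\|\lambda X\|=\lambda\|X\|$ for all real $\lambda\ge 0$ (full homogeneity is not required); $\|UXU^*\|=\|X\|$ for all $U\in\mathbf{U}_n$. The trace inner product on $\mathfrak{u}_n$ is $(A|B)=\mathrm{Tr}(AB^* )=-\mathrm{Tr}(AB)$; every real linear functional on $\mathfrak{u}_n$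 is $\varphi=(N|\,\cdot\,)$ for a unique $N\in\mathfrak{u}_n$. The norm of a functional is $\|\varphi\|=\max\{\varphi(Y):\|Y\|\le 1\}$ (no absolute value). A norming functional for $V$ is a linear functional $\varphi$ with $\|\varphi\|=1$ and $\varphi(V)=\|V\|$. For a norming functional $\varphi$ of $V$, the face is $F_\varphi=\{Y\in\mathfrak{u}_n:\|Y\|\le\|V\|,\ \varphi(Y)=\|V\|\}$. With $V=i\sum_k v_kP_k$ (so $\sum_k P_k=1$), each $X\in\mathfrak{u}_n$ decomposes as $X=X_D+X_C$ with block-diagonal part $X_D=\sum_k P_kXP_k$ and block-codiagonal part $X_C=\sum_{k\ne j}P_kXP_j$. We say $N$ is diagonal with respect to $V$ if $N=i\sum_k n_kP_k$ for some real numbers $n_k$. *)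

theory Defs
  imports "HOL-Analysis.Analysis"
begin

section \<open>Complex matrices and the Lie algebra of skew-Hermitian matrices\<close>

type_synonym 'n cmat = "complex ^ 'n ^ 'n"

definition cscale :: "complex \<Rightarrow> 'n::finite cmat \<Rightarrow> 'n cmat"
  where "cscale c A = map_matrix ((*) c) A"

definition conj_transpose :: "'n::finite cmat \<Rightarrow> 'n cmat"
  where "conj_transpose A = map_matrix cnj (transpose A)"

definition skew_hermitian :: "'n::finite cmat set"
  where "skew_hermitian = {A. conj_transpose A = - A}"

definition unitary_matrices :: "'n::finite cmat set"
  where "unitary_matrices = {U. U ** conj_transpose U = mat 1 \<and> conj_transpose U ** U = mat 1}"

definition commutator :: "'n::finite cmat \<Rightarrow> 'n cmat \<Rightarrow> 'n cmat"
  where "commutator A B = A ** B - B ** A"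

text \<open>On skew-Hermitian matrices the trace of \<open>A B\<^sup>*\<close> is already real, see
  \<open>trace_inner_of_real\<close> below; \<open>Re\<close> only adjusts the type.\<close>

definition trace_inner :: "'n::finite cmat \<Rightarrow> 'n cmat \<Rightarrow> real"
  where "trace_inner A B = Re (trace (A ** conj_transpose B))"


section \<open>Finsler norms, norming functionals, faces\<close>

text \<open>Norms and functionals are total functions on matrices of which only the values on
  \<^const>\<open>skew_hermitian\<close> matter.\<close>

definition Ad_invariant_Finsler_norm :: "('n::finite cmat \<Rightarrow> real) \<Rightarrow> bool"
  where "Ad_invariant_Finsler_norm \<nu> \<longleftrightarrow>
    (\<forall>X\<in>skew_hermitian. 0 \<le> \<nu> X) \<and>
    (\<forall>X\<in>skew_hermitian. \<nu> X = 0 \<longleftrightarrow> X = 0) \<and>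
    (\<forall>X\<in>skew_hermitian. \<forall>Y\<in>skew_hermitian. \<nu> (X + Y) \<le> \<nu> X + \<nu> Y) \<and>
    (\<forall>X\<in>skew_hermitian. \<forall>r\<ge>0. \<nu> (r *\<^sub>R X) = r * \<nu> X) \<and>
    (\<forall>X\<in>skew_hermitian. \<forall>U\<in>unitary_matrices. \<nu> (U ** X ** conj_transpose U) = \<nu> X)"

definition linear_functional :: "('n::finite cmat \<Rightarrow> real) \<Rightarrow> bool"
  where "linear_functional \<phi> \<longleftrightarrow>
    (\<forall>X\<in>skew_hermitian. \<forall>Y\<in>skew_hermitian. \<phi> (X + Y) = \<phi> X + \<phi> Y) \<and>
    (\<forall>X\<in>skew_hermitian. \<forall>r. \<phi> (r *\<^sub>R X) = r * \<phi> X)"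

text \<open>The supremum is a maximum, see \<open>functional_norm_attained\<close> below.\<close>

definition functional_norm :: "('n::finite cmat \<Rightarrow> real) \<Rightarrow> ('n cmat \<Rightarrow> real) \<Rightarrow> real"
  where "functional_norm \<nu> \<phi> = Sup (\<phi> ` {Y \<in> skew_hermitian. \<nu> Y \<le> 1})"

definition norming_functional ::
    "('n::finite cmat \<Rightarrow> real) \<Rightarrow> 'n cmat \<Rightarrow> ('n cmat \<Rightarrow> real) \<Rightarrow> bool"
  where "norming_functional \<nu> V \<phi> \<longleftrightarrow>
    linear_functional \<phi> \<and> functional_norm \<nu> \<phi> = 1 \<and> \<phi> V = \<nu> V"

definition unique_norming_functional ::
    "('n::finite cmat \<Rightarrow> real) \<Rightarrow> 'n cmat \<Rightarrow> ('n cmat \<Rightarrow> real) \<Rightarrow> bool"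
  where "unique_norming_functional \<nu> V \<phi> \<longleftrightarrow>
    norming_functional \<nu> V \<phi> \<and>
    (\<forall>\<psi>. norming_functional \<nu> V \<psi> \<longrightarrow> (\<forall>Y\<in>skew_hermitian. \<psi> Y = \<phi> Y))"

definition norming_face ::
    "('n::finite cmat \<Rightarrow> real) \<Rightarrow> 'n cmat \<Rightarrow> ('n cmat \<Rightarrow> real) \<Rightarrow> 'n cmat set"
  where "norming_face \<nu> V \<phi> = {Y \<in> skew_hermitian. \<nu> Y \<le> \<nu> V \<and> \<phi> Y = \<nu> V}"


section \<open>Spectral resolution and block decomposition\<close>

definition eigenspace :: "'n::finite cmat \<Rightarrow> complex \<Rightarrow> (complex ^ 'n) set"
  where "eigenspace A c = {x. A *v x = c *s x}"

definition eigenvalues :: "'n::finite cmat \<Rightarrow> complex set"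
  where "eigenvalues A = {c. \<exists>x. x \<noteq> 0 \<and> A *v x = c *s x}"

definition orthogonal_projection_onto :: "(complex ^ 'n::finite) set \<Rightarrow> 'n cmat \<Rightarrow> bool"
  where "orthogonal_projection_onto S P \<longleftrightarrow>
    P ** P = P \<and> conj_transpose P = P \<and> range (\<lambda>x. P *v x) = S"

text \<open>\<open>v 1 > \<dots> > v m\<close> are the distinct eigenvalues of \<open>- \<i> V\<close> and \<open>P k\<close> is the orthogonal
  projection onto the eigenspace of \<open>v k\<close>; only indices in \<open>{1..m}\<close> matter. Such data exist for
  every skew-Hermitian \<open>V\<close>, see \<open>spectral_resolution_exists\<close> below.\<close>

definition spectral_resolution ::
    "'n::finite cmat \<Rightarrow> nat \<Rightarrow> (nat \<Rightarrow> real) \<Rightarrow> (nat \<Rightarrow> 'n cmat) \<Rightarrow> bool"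
  where "spectral_resolution V m v P \<longleftrightarrow>
    (\<forall>j\<in>{1..m}. \<forall>k\<in>{1..m}. j < k \<longrightarrow> v k < v j) \<and>
    eigenvalues (cscale (- \<i>) V) = (\<lambda>k. complex_of_real (v k)) ` {1..m} \<and>
    (\<forall>k\<in>{1..m}. orthogonal_projection_onto
        (eigenspace (cscale (- \<i>) V) (complex_of_real (v k))) (P k)) \<and>
    V = cscale \<i> (\<Sum>k\<in>{1..m}. v k *\<^sub>R P k)"

definition block_codiagonal :: "nat \<Rightarrow> (nat \<Rightarrow> 'n::finite cmat) \<Rightarrow> 'n cmat \<Rightarrow> 'n cmat"
  where "block_codiagonal m P X = (\<Sum>k\<in>{1..m}. \<Sum>j\<in>{1..m} - {k}. P k ** X ** P j)"

definition diagonal_wrt :: "nat \<Rightarrow> (nat \<Rightarrow> 'n::finite cmat) \<Rightarrow> 'n cmat \<Rightarrow> bool"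
  where "diagonal_wrt m P N \<longleftrightarrow>
    (\<exists>d :: nat \<Rightarrow> real. N = cscale \<i> (\<Sum>k\<in>{1..m}. d k *\<^sub>R P k))"

section \<open>Sanity checks\<close>

subsection \<open>The trace inner product is real\<close>

lemma conj_transpose_nth: "conj_transpose A $ i $ j = cnj (A $ j $ i)"
  by (simp add: conj_transpose_def transpose_def)

lemma cscale_nth: "cscale c A $ i $ j = c * A $ i $ j"
  by (simp add: cscale_def)

lemma skew_hermitian_nth:
  assumes "A \<in> skew_hermitian"
  shows "cnj (A $ i $ j) = - (A $ j $ i)"
proof -
  have "conj_transpose A $ j $ i = (- A) $ j $ i"
    using assms by (simp add: skew_hermitian_def)
  then show ?thesis by (simp add: conj_transpose_nth)
qed

lemma subspace_skew_hermitian: "subspace (skew_hermitian :: 'n::finite cmat set)"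
  unfolding subspace_def skew_hermitian_def
  by (auto simp: vec_eq_iff conj_transpose_nth)

lemma trace_inner_of_real:
  assumes A: "A \<in> skew_hermitian" and B: "B \<in> skew_hermitian"
  shows "complex_of_real (trace_inner A B) = trace (A ** conj_transpose B)"
    and "complex_of_real (trace_inner A B) = - trace (A ** B)"
proof -
  have eq: "trace (A ** conj_transpose B) = - trace (A ** B)"
    using B by (simp add: trace_def matrix_matrix_mult_def conj_transpose_nth
        skew_hermitian_nth sum_negf)
  have "cnj (trace (A ** B)) = (\<Sum>i\<in>UNIV. \<Sum>k\<in>UNIV. A $ k $ i * B $ i $ k)"
    using A B by (simp add: trace_def matrix_matrix_mult_def skew_hermitian_nth)
  also have "\<dots> = trace (A ** B)"
    unfolding trace_def matrix_matrix_mult_def by (simp, subst sum.swap, simp)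
  finally have "trace (A ** B) \<in> \<real>"
    by (simp add: Reals_cnj_iff)
  then have "trace (A ** conj_transpose B) \<in> \<real>"
    by (simp add: eq)
  then show "complex_of_real (trace_inner A B) = trace (A ** conj_transpose B)"
    by (simp add: trace_inner_def of_real_Re)
  then show "complex_of_real (trace_inner A B) = - trace (A ** B)"
    by (simp add: eq)
qed


subsection \<open>The norm of a functional is a maximum\<close>

definition skew_part :: "'n::finite cmat \<Rightarrow> 'n cmat"
  where "skew_part A = (1/2) *\<^sub>R (A - conj_transpose A)"

lemma skew_part_in: "skew_part A \<in> skew_hermitian"
  by (simp add: skew_part_def skew_hermitian_def vec_eq_iff conj_transpose_nth algebra_simps)

lemma skew_part_eq: "A \<in> skew_hermitian \<Longrightarrow> skew_part A = A"
  by (simp add: skew_part_def vec_eq_iff conj_transpose_nth skew_hermitian_nth complex_eq_iff)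

lemma skew_part_add: "skew_part (A + B) = skew_part A + skew_part B"
  by (simp add: skew_part_def vec_eq_iff conj_transpose_nth algebra_simps)

lemma skew_part_scaleR: "skew_part (r *\<^sub>R A) = r *\<^sub>R skew_part A"
  by (simp add: skew_part_def vec_eq_iff conj_transpose_nth complex_eq_iff algebra_simps)

lemma functional_norm_attained:
  fixes \<nu> :: "'n::finite cmat \<Rightarrow> real"
  assumes \<nu>: "Ad_invariant_Finsler_norm \<nu>" and \<phi>: "linear_functional \<phi>"
  shows "\<exists>Y\<in>skew_hermitian. \<nu> Y \<le> 1 \<and> \<phi> Y = functional_norm \<nu> \<phi> \<and>
           (\<forall>Z\<in>skew_hermitian. \<nu> Z \<le> 1 \<longrightarrow> \<phi> Z \<le> \<phi> Y)"
proof -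
  let ?S = "skew_hermitian :: 'n cmat set"
  let ?B = "{Y \<in> ?S. \<nu> Y \<le> 1}"
  have \<nu>_nn: "0 \<le> \<nu> A" and \<nu>_0: "\<nu> A = 0 \<longleftrightarrow> A = 0"
    and \<nu>_add: "B \<in> ?S \<Longrightarrow> \<nu> (A + B) \<le> \<nu> A + \<nu> B"
    and \<nu>_scale: "0 \<le> r \<Longrightarrow> \<nu> (r *\<^sub>R A) = r * \<nu> A" if "A \<in> ?S" for A B r
    using \<nu> that unfolding Ad_invariant_Finsler_norm_def by blast+
  have S_scale: "r *\<^sub>R A \<in> ?S" if "A \<in> ?S" for A r
    using subspace_skew_hermitian subspace_scale that by blast
  have "convex_on UNIV (\<lambda>A. \<nu> (skew_part A))"
  proof (rule convex_onI)
    fix t :: real and A B :: "'n cmat"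
    assume "0 < t" "t < 1"
    then show "\<nu> (skew_part ((1 - t) *\<^sub>R A + t *\<^sub>R B))
        \<le> (1 - t) * \<nu> (skew_part A) + t * \<nu> (skew_part B)"
      unfolding skew_part_add skew_part_scaleR
      using \<nu>_add[OF S_scale[OF skew_part_in] S_scale[OF skew_part_in], of "1 - t" A t B]
      by (simp add: \<nu>_scale skew_part_in)
  qed simp
  then have "continuous_on UNIV (\<lambda>A. \<nu> (skew_part A))"
    by (rule convex_on_continuous[OF open_UNIV])
  then have "continuous_on ?S (\<lambda>A. \<nu> (skew_part A))"
    by (rule continuous_on_subset) simp
  then have cont_\<nu>: "continuous_on ?S \<nu>"
    by (subst (asm) continuous_on_cong[OF refl, where g = \<nu>]) (simp_all add: skew_part_eq)
  have "linear (\<lambda>A. \<phi> (skew_part A))"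
    using \<phi> unfolding linear_functional_def
    by (intro linearI) (simp_all add: skew_part_add skew_part_scaleR skew_part_in)
  then have "continuous_on ?S (\<lambda>A. \<phi> (skew_part A))"
    by (rule linear_continuous_on[OF linear_conv_bounded_linear[THEN iffD1]])
  then have cont_\<phi>: "continuous_on ?S \<phi>"
    by (subst (asm) continuous_on_cong[OF refl, where g = \<phi>]) (simp_all add: skew_part_eq)
  have closed_S: "closed ?S"
    by (rule closed_subspace[OF subspace_skew_hermitian])
  let ?U = "?S \<inter> sphere 0 1"
  have "\<exists>c>0. \<forall>A\<in>?U. c \<le> \<nu> A"
  proof (cases "?U = {}")
    case True
    then show ?thesis by (auto intro!: exI[of _ 1])
  next
    case False
    have "compact ?U"
      using closed_S by (simp add: closed_Int_compact)
    moreover have "continuous_on ?U \<nu>"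
      using cont_\<nu> by (rule continuous_on_subset) simp
    ultimately obtain A where A: "A \<in> ?U" "\<And>B. B \<in> ?U \<Longrightarrow> \<nu> A \<le> \<nu> B"
      using continuous_attains_inf[OF _ False] by metis
    then have "A \<noteq> 0" by auto
    then have "0 < \<nu> A"
      using \<nu>_nn[of A] \<nu>_0[of A] A(1) by auto
    then show ?thesis using A(2) by auto
  qed
  then obtain c where c: "c > 0" "\<And>A. A \<in> ?U \<Longrightarrow> c \<le> \<nu> A" by blast
  have "norm A \<le> 1 / c" if "A \<in> ?B" for A
  proof (cases "A = 0")
    case False
    then have "inverse (norm A) *\<^sub>R A \<in> ?U"
      using that by (auto intro: S_scale)
    then have "c \<le> \<nu> (inverse (norm A) *\<^sub>R A)"
      by (rule c(2))
    also have "\<dots> = inverse (norm A) * \<nu> A"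
      using that by (intro \<nu>_scale) auto
    also have "\<dots> \<le> inverse (norm A) * 1"
      using that by (intro mult_left_mono) auto
    finally show ?thesis
      using False c(1) by (simp add: field_simps)
  qed (use c(1) in auto)
  then have "bounded ?B"
    unfolding bounded_iff by blast
  moreover have "closed ?B"
    using cont_\<nu> continuous_on_const closed_S by (rule continuous_on_closed_Collect_le)
  ultimately have "compact ?B"
    by (simp add: compact_eq_bounded_closed)
  moreover have "0 \<in> ?S"
    using subspace_skew_hermitian by (rule subspace_0)
  then have "0 \<in> ?B"
    using \<nu>_0[of 0] by simp
  then have "?B \<noteq> {}" by blast
  moreover have "continuous_on ?B \<phi>"
    using cont_\<phi> by (rule continuous_on_subset) auto
  ultimately have "\<exists>Y\<in>?B. \<forall>Z\<in>?B. \<phi> Z \<le> \<phi> Y"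
    by (rule continuous_attains_sup)
  then obtain Y where Y: "Y \<in> ?B" "\<And>Z. Z \<in> ?B \<Longrightarrow> \<phi> Z \<le> \<phi> Y"
    by blast
  have "functional_norm \<nu> \<phi> = \<phi> Y"
    unfolding functional_norm_def using Y by (intro cSup_eq_maximum) auto
  then show ?thesis using Y by auto
qed


subsection \<open>Existence of spectral resolutions\<close>

lemma inner_conj_transpose:
  "inner (A *v x) y = inner x (conj_transpose A *v y)" for x y :: "complex ^ 'n::finite"
proof -
  have "inner (A *v x) y = (\<Sum>i\<in>UNIV. \<Sum>j\<in>UNIV. Re (A $ i $ j * x $ j * cnj (y $ i)))"
    by (simp add: inner_vec_def matrix_vector_mult_def inner_sum_left)
       (simp add: inner_complex_def algebra_simps)
  also have "\<dots> = (\<Sum>j\<in>UNIV. \<Sum>i\<in>UNIV. Re (A $ i $ j * x $ j * cnj (y $ i)))"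
    by (rule sum.swap)
  also have "\<dots> = inner x (conj_transpose A *v y)"
    by (simp add: inner_vec_def matrix_vector_mult_def inner_sum_right conj_transpose_nth)
       (simp add: inner_complex_def algebra_simps)
  finally show ?thesis .
qed

lemma inner_cscale_vec: "inner (c *s x) y = inner x (cnj c *s y)"
  for x y :: "complex ^ 'n::finite"
  by (simp add: inner_vec_def inner_complex_def algebra_simps)

lemma of_real_scale_vec: "complex_of_real r *s x = r *\<^sub>R x" for x :: "complex ^ 'n::finite"
  by (simp add: vec_eq_iff complex_eq_iff)

lemma cscale_matrix_vector: "cscale c A *v x = c *s (A *v x)"
  by (simp add: vec_eq_iff cscale_nth matrix_vector_mult_def sum_distrib_left mult.assoc)

lemma matrix_vector_scale: "A *v (c *s x) = c *s (A *v x)"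
  for x :: "complex ^ 'n::finite"
  by (simp add: vec_eq_iff matrix_vector_mult_def sum_distrib_left algebra_simps)

lemma scaleR_matrix_vector: "(r *\<^sub>R A) *v x = r *\<^sub>R (A *v x)" for A :: "'n::finite cmat"
  by (simp add: vec_eq_iff matrix_vector_mult_def scaleR_right.sum)

lemma matrix_vector_scaleR: "A *v (r *\<^sub>R x) = r *\<^sub>R (A *v x)" for A :: "'n::finite cmat"
  by (simp add: vec_eq_iff matrix_vector_mult_def scaleR_right.sum)

lemma sum_matrix_vector: "(\<Sum>k\<in>K. A k) *v x = (\<Sum>k\<in>K. A k *v x)"
  for A :: "'b \<Rightarrow> 'n::finite cmat"
  by (induction K rule: infinite_finite_induct) (simp_all add: matrix_vector_mult_add_rdistrib)

lemma orthogonal_projection_exists: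
  fixes E :: "(complex ^ 'n::finite) set"
  assumes E: "subspace E" and cE: "\<And>c x. x \<in> E \<Longrightarrow> c *s x \<in> E"
  obtains P where "orthogonal_projection_onto E P"
    and "\<And>x y. y \<in> E \<Longrightarrow> inner (x - P *v x) y = 0"
proof -
  have "\<exists>p. p \<in> E \<and> (\<forall>y\<in>E. inner (x - p) y = 0)" for x
  proof -
    obtain y z where "y \<in> span E" "\<And>w. w \<in> span E \<Longrightarrow> orthogonal z w" "x = y + z"
      using orthogonal_subspace_decomp_exists[of E x] by blast
    moreover have "span E = E" using E by simp
    ultimately show ?thesis
      by (intro exI[of _ y]) (auto simp: orthogonal_def)
  qed
  then obtain p where p: "\<And>x. p x \<in> E" "\<And>x y. y \<in> E \<Longrightarrow> inner (x - p x) y = 0"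
    by metis
  have uniq: "p x = q" if q: "q \<in> E" "\<And>y. y \<in> E \<Longrightarrow> inner (x - q) y = 0" for x q
  proof -
    have "p x - q \<in> E" using p(1) q(1) E by (simp add: subspace_diff)
    then have "inner (p x - q) (p x - q) = 0"
      using p(2)[of "p x - q" x] q(2)[of "p x - q"] by (simp add: inner_diff_left)
    then show ?thesis by simp
  qed
  have "Vector_Spaces.linear (*s) (*s) p"
  proof (rule Vector_Spaces.linear_iff[THEN iffD2], intro conjI allI)
    show "vector_space ((*s) :: complex \<Rightarrow> complex ^ 'n \<Rightarrow> _)"
      by (rule vec.vector_space_axioms)
    then show "vector_space ((*s) :: complex \<Rightarrow> complex ^ 'n \<Rightarrow> _)" .
    show "p (x + y) = p x + p y" for x y
    proof (rule uniq)
      show "p x + p y \<in> E" using p(1) E by (simp add: subspace_add)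
      show "inner (x + y - (p x + p y)) z = 0" if "z \<in> E" for z
        using p(2)[OF that, of x] p(2)[OF that, of y] by (simp add: inner_simps)
    qed
    show "p (c *s x) = c *s p x" for c x
    proof (rule uniq)
      show "c *s p x \<in> E" using p(1) cE by blast
      show "inner (c *s x - c *s p x) z = 0" if "z \<in> E" for z
      proof -
        have "inner (c *s (x - p x)) z = 0"
          using p(2)[OF cE[OF that]] by (simp only: inner_cscale_vec)
        then show ?thesis by (simp add: vector_ssub_ldistrib)
      qed
    qed
  qed
  then have P: "matrix p *v x = p x" for x
    by (simp add: matrix_works)
  have idem: "p x = x" if "x \<in> E" for x
    using that by (intro uniq) auto
  have sym: "inner (p x) y = inner x (p y)" for x y
    using p(2)[OF p(1), of x y] p(2)[OF p(1), of y x]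
    by (simp add: inner_diff_left inner_diff_right inner_commute)
  have "matrix p ** matrix p = matrix p"
    by (simp add: matrix_eq flip: matrix_vector_mul_assoc) (simp add: P idem p(1))
  moreover have "conj_transpose (matrix p) = matrix p"
  proof -
    have "inner x (conj_transpose (matrix p) *v y) = inner x (matrix p *v y)" for x y
      using sym[of x y] by (simp add: P flip: inner_conj_transpose)
    then show ?thesis
      unfolding matrix_eq by (metis vector_eq_ldot)
  qed
  moreover have "range (\<lambda>x. matrix p *v x) = E"
  proof
    show "range (\<lambda>x. matrix p *v x) \<subseteq> E"
      using p(1) by (simp add: P image_subset_iff)
    show "E \<subseteq> range (\<lambda>x. matrix p *v x)"
      using idem by (metis P range_eqI subsetI)
  qed
  ultimately have "orthogonal_projection_onto E (matrix p)"
    by (simp add: orthogonal_projection_onto_def)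
  then show thesis
    by (rule that) (use p(2) in \<open>simp add: P\<close>)
qed

lemma self_adjoint_eigenvector:
  fixes f :: "complex ^ 'n::finite \<Rightarrow> complex ^ 'n"
  assumes f: "linear f" and sym: "\<And>x y. inner (f x) y = inner x (f y)"
    and W: "subspace W" "\<And>x. x \<in> W \<Longrightarrow> f x \<in> W" "W \<noteq> {0}"
  shows "\<exists>x\<in>W. \<exists>t. x \<noteq> 0 \<and> f x = t *\<^sub>R x"
proof -
  let ?U = "W \<inter> sphere 0 1"
  have "compact ?U"
    using W(1) by (simp add: closed_Int_compact closed_subspace)
  moreover obtain w where "w \<in> W" "w \<noteq> 0"
    using W(1,3) subspace_0 by blast
  then have "inverse (norm w) *\<^sub>R w \<in> ?U"
    using W(1) by (auto simp: subspace_scale)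
  then have "?U \<noteq> {}" by blast
  moreover have "continuous_on ?U (\<lambda>x. inner x (f x))"
    using f by (intro continuous_intros linear_continuous_on linear_conv_bounded_linear[THEN iffD1])
  ultimately have "\<exists>x\<in>?U. \<forall>y\<in>?U. inner y (f y) \<le> inner x (f x)"
    by (rule continuous_attains_sup)
  then obtain x where x: "x \<in> ?U" "\<And>y. y \<in> ?U \<Longrightarrow> inner y (f y) \<le> inner x (f x)"
    by blast
  define t where "t = inner x (f x)"
  define q where "q y = t * inner y y - inner y (f y)" for y
  have q_nn: "0 \<le> q y" if y: "y \<in> W" for y
  proof (cases "y = 0")
    case False
    have "inverse (norm y) *\<^sub>R y \<in> ?U"
      using y False W(1) by (auto simp: subspace_scale)
    from x(2)[OF this] have "inner y (f y) / (norm y)\<^sup>2 \<le> t"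
      using f by (simp add: linear_scale t_def power2_eq_square divide_inverse mult_ac)
    then show ?thesis
      using False by (simp add: q_def divide_le_eq power2_norm_eq_inner)
  qed (simp add: q_def)
  define w where "w = t *\<^sub>R x - f x"
  have wW: "w \<in> W"
    using x(1) W(1,2) by (simp add: w_def subspace_diff subspace_scale)
  have "inner x x = 1"
    using x(1) by (simp add: norm_eq_sqrt_inner)
  then have q_exp: "q (x + s *\<^sub>R w) = 2 * s * inner w w + s\<^sup>2 * q w" for s
    using f sym[of x w] sym[of w x]
    by (simp add: q_def linear_add linear_scale t_def[symmetric])
       (simp add: w_def inner_simps inner_commute power2_eq_square algebra_simps t_def)
  have "inner w w = 0"
  proof (rule ccontr)
    assume nz: "inner w w \<noteq> 0"
    then have b: "0 < inner w w" by (simp add: inner_gt_zero_iff)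
    define g where "g = q w"
    have g: "0 \<le> g" using q_nn[OF wW] by (simp add: g_def)
    define s where "s = - inner w w / (g + 1)"
    have "x + s *\<^sub>R w \<in> W"
      using x(1) wW W(1) by (simp add: subspace_add subspace_scale)
    then have "0 \<le> s * (2 * inner w w + s * g)"
      using q_nn[of "x + s *\<^sub>R w"] q_exp[of s] by (simp add: g_def power2_eq_square algebra_simps)
    moreover have "s < 0"
      using b g by (simp add: s_def)
    moreover have "0 < 2 * inner w w + s * g"
    proof -
      have "- s * g \<le> inner w w"
        using b g by (simp add: s_def field_simps)
      then show ?thesis using b by linarith
    qed
    ultimately show False
      using mult_neg_pos[of s "2 * inner w w + s * g"] by linarith
  qed
  then have "f x = t *\<^sub>R x"
    by (simp add: w_def)
  moreover have "x \<noteq> 0"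
    using x(1) by auto
  ultimately show ?thesis using x(1) by blast
qed

lemma spectral_resolution_exists:
  fixes V :: "'n::finite cmat"
  assumes V: "V \<in> skew_hermitian"
  shows "\<exists>m v P. spectral_resolution V m v P"
proof -
  define H where "H = cscale (- \<i>) V"
  define T where "T = {t. complex_of_real t \<in> eigenvalues H}"
  let ?E = "\<lambda>t. eigenspace H (complex_of_real t)"
  have E: "x \<in> ?E t \<longleftrightarrow> H *v x = t *\<^sub>R x" for x t
    by (simp add: eigenspace_def of_real_scale_vec)
  have VH: "V = cscale \<i> H"
    by (simp add: H_def vec_eq_iff cscale_nth)
  have "conj_transpose H = H"
    using V by (simp add: H_def vec_eq_iff conj_transpose_nth cscale_nth skew_hermitian_nth)
  then have sym: "inner (H *v x) y = inner x (H *v y)" for x y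
    by (metis inner_conj_transpose)
  have lin: "linear ((*v) H)"
    by (rule linearI) (simp_all add: matrix_vector_right_distrib matrix_vector_scaleR)
  have sub: "subspace (?E t)" for t
    using lin unfolding subspace_def
    by (auto simp: E linear_add linear_scale linear_0 scaleR_add_right)
  have csub: "c *s x \<in> ?E t" if "x \<in> ?E t" for c x t
    using that by (simp add: eigenspace_def matrix_vector_scale mult.commute vector_smult_assoc)
  have real_ev: "c \<in> complex_of_real ` T" if c: "c \<in> eigenvalues H" for c
  proof -
    obtain x where x: "x \<noteq> 0" "H *v x = c *s x"
      using c by (auto simp: eigenvalues_def)
    have inner_scale: "inner (a *s x) (b *s x) = Re (a * cnj b) * inner x x" for a b
      unfolding inner_vec_def sum_distrib_left
      by (intro sum.cong) (simp_all add: inner_complex_def algebra_simps)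
    have "inner (c *s x) (\<i> *s x) = inner (1 *s x) ((\<i> * c) *s x)"
      using sym[of x "\<i> *s x"] by (simp add: x(2) matrix_vector_scale vector_smult_assoc)
    then have "Im c * inner x x = 0"
      unfolding inner_scale by simp
    then have "Im c = 0" using x(1) by simp
    then have "c = complex_of_real (Re c)" by (simp add: complex_eq_iff)
    then show ?thesis using c by (auto simp: T_def)
  qed
  have ortho: "inner x y = 0" if "x \<in> ?E s" "y \<in> ?E t" "s \<noteq> t" for x y s t
    using sym[of x y] that by (simp add: E)
  have "finite T"
  proof -
    have "\<forall>t\<in>T. \<exists>x. x \<noteq> 0 \<and> x \<in> ?E t"
      by (auto simp: T_def eigenvalues_def eigenspace_def)
    then obtain u where u: "\<And>t. t \<in> T \<Longrightarrow> u t \<noteq> 0 \<and> u t \<in> ?E t"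
      by metis
    have inj: "inj_on u T"
      using u ortho by (intro inj_onI) (metis inner_eq_zero_iff)
    have "pairwise orthogonal (u ` T)"
      using u ortho by (fastforce simp: pairwise_def orthogonal_def)
    then have "finite (u ` T)"
      by (rule pairwise_orthogonal_imp_finite)
    then show ?thesis using inj by (rule finite_imageD)
  qed
  have "\<exists>A. orthogonal_projection_onto (?E t) A \<and> (\<forall>x. \<forall>y\<in>?E t. inner (x - A *v x) y = 0)"
    for t
    by (rule orthogonal_projection_exists[OF sub[of t] csub]) blast+
  then have "\<exists>Q. \<forall>t. orthogonal_projection_onto (?E t) (Q t) \<and>
      (\<forall>x. \<forall>y\<in>?E t. inner (x - Q t *v x) y = 0)"
    by (intro choice) blast
  then obtain Q where Q: "\<And>t. orthogonal_projection_onto (?E t) (Q t)"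
      "\<And>t x y. y \<in> ?E t \<Longrightarrow> inner (x - Q t *v x) y = 0"
    by blast
  have QE: "Q t *v x \<in> ?E t" for t x
    using Q(1)[of t] unfolding orthogonal_projection_onto_def by blast
  define W where "W = {x. \<forall>t\<in>T. \<forall>y\<in>?E t. inner x y = 0}"
  have W0: "W = {0}"
  proof (rule ccontr)
    assume ne: "W \<noteq> {0}"
    have "subspace W"
      by (auto simp: W_def subspace_def inner_simps)
    moreover have "H *v x \<in> W" if "x \<in> W" for x
      using that by (auto simp: W_def sym E)
    ultimately obtain x t where x: "x \<in> W" "x \<noteq> 0" "H *v x = t *\<^sub>R x"
      using self_adjoint_eigenvector[OF lin sym _ _ ne] by blast
    then have "t \<in> T"
      by (auto simp: T_def eigenvalues_def of_real_scale_vec)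
    then have "inner x x = 0"
      using x by (auto simp: W_def E)
    then show False using x(2) by simp
  qed
  have sumQ: "(\<Sum>t\<in>T. Q t *v x) = x" for x
  proof -
    have "x - (\<Sum>t\<in>T. Q t *v x) \<in> W"
      unfolding W_def
    proof (intro CollectI ballI)
      fix s y assume s: "s \<in> T" and y: "y \<in> ?E s"
      have "inner (\<Sum>t\<in>T. Q t *v x) y = (\<Sum>t\<in>T. if t = s then inner (Q s *v x) y else 0)"
        unfolding inner_sum_left using ortho[OF QE y] by (intro sum.cong) auto
      also have "\<dots> = inner x y"
        using s \<open>finite T\<close> Q(2)[OF y, of x] by (simp add: inner_diff_left)
      finally show "inner (x - (\<Sum>t\<in>T. Q t *v x)) y = 0"
        by (simp add: inner_diff_left)
    qed
    then show ?thesis by (simp add: W0)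
  qed
  have H: "H = (\<Sum>t\<in>T. t *\<^sub>R Q t)"
    unfolding matrix_eq
  proof
    fix x
    have "H *v x = H *v (\<Sum>t\<in>T. Q t *v x)"
      by (simp add: sumQ)
    also have "\<dots> = (\<Sum>t\<in>T. H *v (Q t *v x))"
      using lin by (rule linear_sum)
    also have "\<dots> = (\<Sum>t\<in>T. t *\<^sub>R (Q t *v x))"
      using QE by (intro sum.cong) (auto simp: E)
    finally show "H *v x = (\<Sum>t\<in>T. t *\<^sub>R Q t) *v x"
      by (simp add: sum_matrix_vector scaleR_matrix_vector)
  qed
  define L where "L = rev (sorted_list_of_set T)"
  define v where "v k = L ! (k - 1)" for k
  define P where "P k = Q (v k)" for k
  have len: "length L = card T" and setL: "set L = T"
    using \<open>finite T\<close> by (simp_all add: L_def)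
  have dec: "v k < v j" if "j \<in> {1..card T}" "k \<in> {1..card T}" "j < k" for j k
    using strict_sorted_list_of_set[of T] that len
    unfolding v_def L_def by (auto simp: rev_nth intro!: sorted_wrt_nth_less[of "(<)"])
  have img: "v ` {1..card T} = T"
  proof -
    have "v ` {1..card T} = (!) L ` {..<card T}"
      unfolding v_def image_Suc_lessThan[symmetric] by (simp add: image_image)
    also have "\<dots> = T"
      using len setL by (auto simp: set_conv_nth)
    finally show ?thesis .
  qed
  have inj: "inj_on v {1..card T}"
    using dec by (intro inj_onI) (metis less_irrefl linorder_neqE_nat)
  have "(\<Sum>k\<in>{1..card T}. v k *\<^sub>R P k) = H"
    unfolding H P_def using sum.reindex[OF inj, of "\<lambda>t. t *\<^sub>R Q t"] img by simp
  moreover have "eigenvalues H = complex_of_real ` T"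
    using real_ev by (auto simp: T_def)
  then have "eigenvalues H = (\<lambda>k. complex_of_real (v k)) ` {1..card T}"
    using arg_cong[OF img, of "(`) complex_of_real"] by (simp add: image_image)
  ultimately have "spectral_resolution V (card T) v P"
    unfolding spectral_resolution_def H_def[symmetric]
    using dec Q(1) VH by (simp add: P_def)
  then show ?thesis by blast
qed

end

theory Submission
  imports Defs
begin

text \<open>A norming functional \<open>(N|\<cdot>)\<close> of \<open>V\<close> is maximal at \<open>V\<close> on the unitary orbit of \<open>V\<close>. Moving
  along the orbit with Cayley transforms \<open>U = (1 + Z)(1 - Z)\<^sup>-\<^sup>1\<close>, for which
  \<open>U V U\<^sup>* - V = 2 A [Z,V] A\<^sup>*\<close> with \<open>A = (1 - Z)\<^sup>-\<^sup>1\<close>, the first and second order conditions at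
  \<open>Z = 0\<close> are \<open>[N,V] = 0\<close> and \<open>([Z,N]|[Z,V]) \<ge> 0\<close>. Since \<open>ad N\<close> and \<open>ad V\<close> commute, the latter form
  is symmetric, so its value \<open>-\<phi>([X,[X,V]])\<close> at \<open>X\<close> vanishes only if \<open>X\<close> lies in its kernel, that
  is \<open>[N,[X\<^sub>C,V]] = 0\<close>. Then \<open>[N,X\<^sub>C]\<close> commutes with \<open>V\<close> while being block-codiagonal, hence is zero.
  If the face is \<open>{V}\<close>, conjugation by the Cayley transform of \<open>X\<^sub>C\<close> fixes \<open>N\<close>, so it keeps \<open>V\<close> in
  the face and must fix \<open>V\<close>. If the norming functional is unique, \<open>N\<close> is fixed by all unitaries
  commuting with \<open>V\<close>, so it is scalar on each eigenspace.\<close>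

section \<open>Matrix algebra\<close>

lemma bounded_bilinear_matrix_mult: "bounded_bilinear ((**) :: 'n::finite cmat \<Rightarrow> _)"
  unfolding bilinear_conv_bounded_bilinear[symmetric]
  by (auto simp: bilinear_def vec_eq_iff matrix_matrix_mult_def sum.distrib
      distrib_left distrib_right scaleR_right.sum intro!: linearI)

interpretation matrix_mult: bounded_bilinear "(**) :: 'n::finite cmat \<Rightarrow> _"
  by (rule bounded_bilinear_matrix_mult)

lemmas matrix_mult_algebra =
  matrix_mult.add_left matrix_mult.add_right matrix_mult.diff_left matrix_mult.diff_right
  matrix_mult.minus_left matrix_mult.minus_right matrix_mult.scaleR_left matrix_mult.scaleR_right
  matrix_mult.zero_left matrix_mult.zero_right

lemma conj_transpose_mult: "conj_transpose (A ** B) = conj_transpose B ** conj_transpose A"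
  by (simp add: vec_eq_iff conj_transpose_nth matrix_matrix_mult_def mult.commute)

lemma conj_transpose_conj_transpose [simp]: "conj_transpose (conj_transpose A) = A"
  by (simp add: vec_eq_iff conj_transpose_nth)

lemma linear_conj_transpose: "linear conj_transpose"
  by (rule linearI) (simp_all add: vec_eq_iff conj_transpose_nth)

lemmas conj_transpose_add = linear_add[OF linear_conj_transpose]
  and conj_transpose_diff = linear_diff[OF linear_conj_transpose]

lemma conj_transpose_mat_1 [simp]: "conj_transpose (mat 1) = mat 1"
  by (simp add: vec_eq_iff conj_transpose_nth mat_def)

lemma cscale_mult_left: "cscale c A ** B = cscale c (A ** B)"
  by (simp add: vec_eq_iff cscale_nth matrix_matrix_mult_def sum_distrib_left mult.assoc)

lemma cscale_mult_right: "A ** cscale c B = cscale c (A ** B)"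
  by (simp add: vec_eq_iff cscale_nth matrix_matrix_mult_def sum_distrib_left mult.left_commute)

lemma conj_transpose_cscale: "conj_transpose (cscale c A) = cscale (cnj c) (conj_transpose A)"
  by (simp add: vec_eq_iff conj_transpose_nth cscale_nth)

lemma skew_hermitian_iff: "A \<in> skew_hermitian \<longleftrightarrow> conj_transpose A = - A"
  by (simp add: skew_hermitian_def)

lemma skew_hermitian_diff:
  "A \<in> skew_hermitian \<Longrightarrow> B \<in> skew_hermitian \<Longrightarrow> A - B \<in> skew_hermitian"
  using subspace_diff subspace_skew_hermitian by blast

lemma skew_hermitian_add:
  "A \<in> skew_hermitian \<Longrightarrow> B \<in> skew_hermitian \<Longrightarrow> A + B \<in> skew_hermitian"
  using subspace_add subspace_skew_hermitian by blast

lemma skew_hermitian_scaleR: "A \<in> skew_hermitian \<Longrightarrow> r *\<^sub>R A \<in> skew_hermitian"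
  using subspace_scale subspace_skew_hermitian by blast

lemma skew_hermitian_congruence:
  "A \<in> skew_hermitian \<Longrightarrow> B ** A ** conj_transpose B \<in> skew_hermitian"
  by (simp add: skew_hermitian_iff conj_transpose_mult matrix_mult_algebra matrix_mul_assoc)

text \<open>Extends complex-linear identities from skew-Hermitian matrices to all matrices, so that
  matrix units become available.\<close>

lemma skew_part_decomposition: "A = skew_part A + cscale \<i> (skew_part (cscale (- \<i>) A))"
  by (simp add: skew_part_def vec_eq_iff conj_transpose_nth cscale_nth complex_eq_iff field_simps)

text \<open>Gives access to the positivity and continuity of the built-in Euclidean inner
  product.\<close>

lemma trace_inner_eq_inner: "trace_inner A B = inner A B"
  by (simp add: trace_inner_def trace_def matrix_matrix_mult_def inner_vec_def conj_transpose_nth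
      inner_complex_def)

lemma inner_mult_left: "inner (A ** B) C = inner B (conj_transpose A ** C)"
  for A :: "'n::finite cmat"
proof -
  have "inner (A ** B) C = (\<Sum>i\<in>UNIV. \<Sum>j\<in>UNIV. \<Sum>k\<in>UNIV. Re (A $ i $ k * B $ k $ j * cnj (C $ i $ j)))"
    by (simp add: inner_vec_def matrix_matrix_mult_def inner_sum_left)
       (simp add: inner_complex_def algebra_simps)
  also have "\<dots> = (\<Sum>i\<in>UNIV. \<Sum>k\<in>UNIV. \<Sum>j\<in>UNIV. Re (A $ i $ k * B $ k $ j * cnj (C $ i $ j)))"
    by (rule sum.cong[OF refl], rule sum.swap)
  also have "\<dots> = (\<Sum>k\<in>UNIV. \<Sum>i\<in>UNIV. \<Sum>j\<in>UNIV. Re (A $ i $ k * B $ k $ j * cnj (C $ i $ j)))"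
    by (rule sum.swap)
  also have "\<dots> = (\<Sum>k\<in>UNIV. \<Sum>j\<in>UNIV. \<Sum>i\<in>UNIV. Re (A $ i $ k * B $ k $ j * cnj (C $ i $ j)))"
    by (rule sum.cong[OF refl], rule sum.swap)
  also have "\<dots> = inner B (conj_transpose A ** C)"
    by (simp add: inner_vec_def matrix_matrix_mult_def inner_sum_right conj_transpose_nth)
       (simp add: inner_complex_def algebra_simps)
  finally show ?thesis .
qed

lemma inner_conj_transpose_both: "inner (conj_transpose A) (conj_transpose B) = inner A B"
  for A :: "'n::finite cmat"
  unfolding inner_vec_def conj_transpose_nth
  by (subst sum.swap) (simp add: inner_complex_def)

lemma inner_mult_right: "inner (A ** B) C = inner A (C ** conj_transpose B)"
  for A :: "'n::finite cmat"
  using inner_mult_left[of "conj_transpose B" "conj_transpose A" "conj_transpose C"]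
  by (metis conj_transpose_mult conj_transpose_conj_transpose inner_conj_transpose_both)

section \<open>Commutators\<close>

lemma commutator_flip: "commutator A B = - commutator B A"
  by (simp add: commutator_def)

lemma commutator_add_left: "commutator (A + B) C = commutator A C + commutator B C"
  by (simp add: commutator_def matrix_mult_algebra)

lemma commutator_scaleR_left: "commutator (r *\<^sub>R A) B = r *\<^sub>R commutator A B"
  by (simp add: commutator_def matrix_mult_algebra algebra_simps)

lemma commutator_eq_0_iff: "commutator A B = 0 \<longleftrightarrow> A ** B = B ** A"
  by (simp add: commutator_def)

lemma commutator_skew:
  "A \<in> skew_hermitian \<Longrightarrow> B \<in> skew_hermitian \<Longrightarrow> commutator A B \<in> skew_hermitian"
  by (simp add: skew_hermitian_iff commutator_def conj_transpose_diff conj_transpose_mult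
      matrix_mult_algebra)

lemma inner_commutator_left:
  "A \<in> skew_hermitian \<Longrightarrow> inner (commutator A B) C = - inner B (commutator A C)"
  by (simp add: commutator_def inner_diff_left inner_diff_right inner_mult_left[of A]
      inner_mult_right[of B] skew_hermitian_iff matrix_mult_algebra)

text \<open>This is the Jacobi identity with one vanishing term.\<close>

lemma commutator_commutator_commute:
  assumes "A ** B = B ** A"
  shows "commutator A (commutator C B) = commutator (commutator A C) B"
proof -
  have "A ** B ** C = B ** A ** C" and "C ** A ** B = C ** B ** A"
    using assms by (simp_all flip: matrix_mul_assoc)
  then show ?thesis
    by (simp add: commutator_def matrix_mult_algebra matrix_mul_assoc algebra_simps)
qed

section \<open>The Cayley transform\<close>

definition resolvent :: "'n::finite cmat \<Rightarrow> 'n cmat"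
  where "resolvent Z = matrix_inv (mat 1 - Z)"

definition cayley :: "'n::finite cmat \<Rightarrow> 'n cmat"
  where "cayley Z = (mat 1 + Z) ** resolvent Z"

text \<open>The value is its own negative. This yields both the injectivity of 1 - Z and the
  contractivity of its inverse.\<close>

lemma inner_skew_self:
  fixes x :: "complex ^ 'n::finite"
  assumes "Z \<in> skew_hermitian"
  shows "inner x (Z *v x) = 0"
proof -
  have "inner (Z *v x) x = - inner x (Z *v x)"
    using assms matrix_vector_mult_diff_rdistrib[of 0 Z x]
    by (simp add: inner_conj_transpose skew_hermitian_iff)
  then show ?thesis by (simp add: inner_commute)
qed

text \<open>If \<open>Z\<close> fixes \<open>x\<close>, then |x|^2 = (x|Z x) = 0. So 1 - Z is
  injective, hence invertible in finite dimension, and \<open>matrix_inv\<close> is a genuine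
  two-sided inverse.\<close>

lemma
  fixes Z :: "'n::finite cmat"
  assumes Z: "Z \<in> skew_hermitian"
  shows resolvent_left: "resolvent Z ** (mat 1 - Z) = mat 1"
    and resolvent_right: "(mat 1 - Z) ** resolvent Z = mat 1"
proof -
  have "inj ((*v) (mat 1 - Z))"
  proof (rule injI)
    fix x y assume "(mat 1 - Z) *v x = (mat 1 - Z) *v y"
    then have "Z *v (x - y) = x - y"
      by (simp add: matrix_vector_mult_diff_rdistrib matrix_vector_mult_diff_distrib algebra_simps)
    then have "inner (x - y) (x - y) = 0"
      using inner_skew_self[OF Z, of "x - y"] by simp
    then show "x = y" by simp
  qed
  then have "invertible (mat 1 - Z)"
    by (simp add: invertible_left_inverse matrix_left_invertible_injective)
  then show "resolvent Z ** (mat 1 - Z) = mat 1" "(mat 1 - Z) ** resolvent Z = mat 1"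
    unfolding resolvent_def matrix_inv_def invertible_def by (metis (mono_tags, lifting) someI_ex)+
qed


lemma resolvent_fixpoint:
  assumes "Z \<in> skew_hermitian"
  shows "resolvent Z - mat 1 = Z ** resolvent Z"
  using resolvent_right[OF assms] by (simp add: matrix_mult_algebra algebra_simps)

lemma conj_transpose_resolvent:
  assumes "Z \<in> skew_hermitian"
  shows "(mat 1 + Z) ** conj_transpose (resolvent Z) = mat 1"
    and "conj_transpose (resolvent Z) ** (mat 1 + Z) = mat 1"
  using arg_cong[OF resolvent_left[OF assms], of conj_transpose]
    arg_cong[OF resolvent_right[OF assms], of conj_transpose] assms
  by (simp_all add: conj_transpose_mult conj_transpose_diff skew_hermitian_iff)

lemma cayley_eq:
  assumes "Z \<in> skew_hermitian"
  shows "cayley Z = 2 *\<^sub>R resolvent Z - mat 1" and "cayley Z = resolvent Z ** (mat 1 + Z)"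
proof -
  have "resolvent Z ** Z = resolvent Z - mat 1" "Z ** resolvent Z = resolvent Z - mat 1"
    using resolvent_left[OF assms] resolvent_right[OF assms]
    by (simp_all add: matrix_mult_algebra algebra_simps)
  then show "cayley Z = 2 *\<^sub>R resolvent Z - mat 1" "cayley Z = resolvent Z ** (mat 1 + Z)"
    by (simp_all add: cayley_def matrix_mult_algebra scaleR_2)
qed

lemma conj_transpose_cayley:
  assumes "Z \<in> skew_hermitian"
  shows "conj_transpose (cayley Z) = (mat 1 - Z) ** conj_transpose (resolvent Z)"
  using assms by (simp add: cayley_eq(2) conj_transpose_mult conj_transpose_add skew_hermitian_iff)

lemma resolvent_cayley:
  assumes "Z \<in> skew_hermitian"
  shows "resolvent Z ** conj_transpose (cayley Z) = conj_transpose (resolvent Z)"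
  using assms by (simp add: conj_transpose_cayley resolvent_left matrix_mul_assoc)

lemma cayley_unitary:
  assumes "Z \<in> skew_hermitian"
  shows "cayley Z \<in> unitary_matrices"
proof -
  have "cayley Z ** conj_transpose (cayley Z) = mat 1"
    by (subst cayley_def) (simp add: assms resolvent_cayley conj_transpose_resolvent
        flip: matrix_mul_assoc)
  then show ?thesis
    by (simp add: unitary_matrices_def matrix_left_right_inverse)
qed

lemma cayley_conj:
  assumes Z: "Z \<in> skew_hermitian"
  shows "cayley Z ** V ** conj_transpose (cayley Z) - V
    = 2 *\<^sub>R (resolvent Z ** commutator Z V ** conj_transpose (resolvent Z))"
proof -
  let ?A = "resolvent Z" and ?U = "cayley Z"
  have "V = V ** (?U ** conj_transpose ?U)"
    using cayley_unitary[OF Z] by (simp add: unitary_matrices_def)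
  then have "?U ** V ** conj_transpose ?U - V = (?U ** V - V ** ?U) ** conj_transpose ?U"
    by (simp add: matrix_mult_algebra matrix_mul_assoc)
  also have "?U ** V - V ** ?U = 2 *\<^sub>R (?A ** V - V ** ?A)"
    using Z by (simp add: cayley_eq(1) matrix_mult_algebra algebra_simps)
  \<comment> \<open>Inserts 1 = (1 - Z) A to the right of A V and 1 = A (1 - Z) to the left of V A:
    the terms A V A cancel and only the commutator with \<open>Z\<close> survives.\<close>
  also have "?A ** V - V ** ?A
      = ?A ** V ** ((mat 1 - Z) ** ?A) - (?A ** (mat 1 - Z)) ** V ** ?A"
    using Z by (simp add: resolvent_left resolvent_right)
  also have "\<dots> = ?A ** commutator Z V ** ?A"
    by (simp add: commutator_def matrix_mult_algebra matrix_mul_assoc)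
  finally show ?thesis
    using Z by (simp add: matrix_mult_algebra resolvent_cayley flip: matrix_mul_assoc)
qed

text \<open>The resolvent factors in \<open>cayley_conj\<close> are invertible and can be stripped
  off. Used for \<open>V\<close> and for \<open>N\<close>, to pass between commutators and
  invariance under a unitary.\<close>

lemma cayley_conj_eq_iff:
  assumes Z: "Z \<in> skew_hermitian"
  shows "cayley Z ** V ** conj_transpose (cayley Z) = V \<longleftrightarrow> commutator Z V = 0"
proof
  let ?A = "resolvent Z" and ?B = "conj_transpose (resolvent Z)"
  assume "cayley Z ** V ** conj_transpose (cayley Z) = V"
  then have "?A ** commutator Z V ** ?B = 0"
    using cayley_conj[OF Z, of V] by simp
  then have "(mat 1 - Z) ** (?A ** commutator Z V ** ?B) ** (mat 1 + Z) = 0"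
    by (simp add: matrix_mult_algebra)
  moreover have "(mat 1 - Z) ** (?A ** commutator Z V ** ?B) ** (mat 1 + Z)
      = ((mat 1 - Z) ** ?A) ** commutator Z V ** (?B ** (mat 1 + Z))"
    by (simp only: matrix_mul_assoc)
  ultimately show "commutator Z V = 0"
    using Z by (simp add: resolvent_right conj_transpose_resolvent)
next
  assume "commutator Z V = 0"
  then show "cayley Z ** V ** conj_transpose (cayley Z) = V"
    using cayley_conj[OF Z, of V] by (simp add: matrix_mult_algebra)
qed

text \<open>For x = (1 - Z) y the inner product of y and x is |y|^2, since \<open>Z\<close>
  contributes nothing; Cauchy-Schwarz then gives |y| <= |x|.\<close>

lemma norm_resolvent_le:
  fixes x :: "complex ^ 'n::finite"
  assumes Z: "Z \<in> skew_hermitian"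
  shows "norm (resolvent Z *v x) \<le> norm x"
proof -
  define y where "y = resolvent Z *v x"
  have "x = (mat 1 - Z) *v y"
    using resolvent_right[OF Z] by (simp add: y_def matrix_vector_mul_assoc)
  then have "inner y x = inner y y"
    using inner_skew_self[OF Z, of y]
    by (simp add: matrix_vector_mult_diff_rdistrib inner_diff_right)
  then have "norm y * norm y \<le> norm y * norm x"
    using norm_cauchy_schwarz[of y x] by (simp add: power2_norm_eq_inner[symmetric] power2_eq_square)
  then show ?thesis
    unfolding y_def[symmetric] by (cases "y = 0") auto
qed

lemma norm_resolvent_nth_le:
  assumes "Z \<in> skew_hermitian"
  shows "norm (resolvent Z $ i $ j) \<le> 1"
proof -
  have "resolvent Z $ i $ j = (resolvent Z *v axis j 1) $ i"
    by (simp add: matrix_vector_mult_def axis_def if_distrib[of "(*) _"] cong: if_cong)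
  also have "norm \<dots> \<le> norm (resolvent Z *v axis j 1)"
    by (rule Finite_Cartesian_Product.norm_nth_le)
  also have "\<dots> \<le> norm (axis j 1 :: complex ^ 'a)"
    by (rule norm_resolvent_le[OF assms])
  finally show ?thesis by (simp add: norm_axis_1)
qed

lemma resolvent_tendsto:
  assumes Z: "Z \<in> skew_hermitian"
  shows "((\<lambda>t. resolvent (t *\<^sub>R Z)) \<longlongrightarrow> mat 1) (at_right 0)"
proof (intro vec_tendstoI)
  fix i j
  let ?A = "\<lambda>t. resolvent (t *\<^sub>R Z)"
  \<comment> \<open>Since A - 1 = t Z A and the entries of A are bounded by 1, this row sum controls
    the entry linearly in t.\<close>
  define K where "K = (\<Sum>k\<in>UNIV. norm (Z $ i $ k))"
  have "norm (?A t $ i $ j - mat 1 $ i $ j) \<le> t * K" if "t > 0" for t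
  proof -
    have tZ: "t *\<^sub>R Z \<in> skew_hermitian"
      using Z by (rule skew_hermitian_scaleR)
    have "?A t $ i $ j - mat 1 $ i $ j = t *\<^sub>R (\<Sum>k\<in>UNIV. Z $ i $ k * ?A t $ k $ j)"
    proof -
      have "?A t - mat 1 = t *\<^sub>R (Z ** ?A t)"
        unfolding resolvent_fixpoint[OF tZ] by (rule matrix_mult.scaleR_left)
      then have "(?A t - mat 1) $ i $ j = (t *\<^sub>R (Z ** ?A t)) $ i $ j"
        by (rule arg_cong)
      moreover have "(Z ** ?A t) $ i $ j = (\<Sum>k\<in>UNIV. Z $ i $ k * ?A t $ k $ j)"
        by (simp add: matrix_matrix_mult_def)
      ultimately show ?thesis
        by (simp only: vector_minus_component vector_scaleR_component)
    qed
    also have "norm \<dots> = t * norm (\<Sum>k\<in>UNIV. Z $ i $ k * ?A t $ k $ j)"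
      using that by (simp only: norm_scaleR abs_of_pos)
    also have "\<dots> \<le> t * K"
      unfolding K_def
    proof (intro mult_left_mono sum_norm_le)
      show "norm (Z $ i $ k * ?A t $ k $ j) \<le> norm (Z $ i $ k)" for k
        unfolding norm_mult using norm_resolvent_nth_le[OF tZ] by (rule mult_left_le) (rule norm_ge_zero)
    qed (use that in simp)
    finally show ?thesis .
  qed
  then have "eventually (\<lambda>t. norm (?A t $ i $ j - mat 1 $ i $ j) \<le> t * K) (at_right 0)"
    by (auto simp: eventually_at_filter)
  moreover have "((\<lambda>t. t * K) \<longlongrightarrow> 0 * K) (at_right 0)"
    by (intro tendsto_intros)
  ultimately have "((\<lambda>t. ?A t $ i $ j - mat 1 $ i $ j) \<longlongrightarrow> 0) (at_right 0)"
    using Lim_null_comparison by force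
  then show "((\<lambda>t. ?A t $ i $ j) \<longlongrightarrow> mat 1 $ i $ j) (at_right 0)"
    by (rule LIM_zero_cancel)
qed

section \<open>First and second order conditions on the unitary orbit\<close>

lemma second_order_maximality:
  fixes N V Z :: "'n::finite cmat"
  assumes max: "\<And>U. U \<in> unitary_matrices \<Longrightarrow> inner N (U ** V ** conj_transpose U) \<le> inner N V"
    and N: "N \<in> skew_hermitian" and V: "V \<in> skew_hermitian"
  shows "commutator N V = 0"
    and "Z \<in> skew_hermitian \<Longrightarrow> 0 \<le> inner (commutator Z N) (commutator Z V)"
proof -
  let ?A = "\<lambda>Z t. resolvent (t *\<^sub>R Z)"
  \<comment> \<open>By \<open>cayley_conj\<close>, conjugating \<open>V\<close> by the Cayley
    transform of t Z changes it by exactly 2 t C.\<close>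
  define C where "C Z t = ?A Z t ** commutator Z V ** conj_transpose (?A Z t)" for Z t
  have le: "inner N (C Z t) \<le> 0" if Z: "Z \<in> skew_hermitian" and t: "t > 0" for Z t
  proof -
    have tZ: "t *\<^sub>R Z \<in> skew_hermitian"
      using Z by (rule skew_hermitian_scaleR)
    have "inner N (cayley (t *\<^sub>R Z) ** V ** conj_transpose (cayley (t *\<^sub>R Z)) - V) \<le> 0"
      using max[OF cayley_unitary[OF tZ]] by (simp add: inner_diff_right)
    then have "2 * t * inner N (C Z t) \<le> 0"
      unfolding cayley_conj[OF tZ]
      by (simp add: C_def commutator_scaleR_left matrix_mult_algebra)
    then show ?thesis using t by (simp add: mult_le_0_iff)
  qed
  have lim: "((\<lambda>t. C Z t) \<longlongrightarrow> commutator Z V) (at_right 0)" if Z: "Z \<in> skew_hermitian" for Z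
  proof -
    have "((\<lambda>t. C Z t) \<longlongrightarrow> mat 1 ** commutator Z V ** conj_transpose (mat 1)) (at_right 0)"
      unfolding C_def
      by (intro matrix_mult.tendsto tendsto_const resolvent_tendsto[OF Z]
          bounded_linear.tendsto[OF linear_conv_bounded_linear[THEN iffD1, OF linear_conj_transpose]])
    then show ?thesis by simp
  qed
  have first: "inner N (commutator Z V) \<le> 0" if Z: "Z \<in> skew_hermitian" for Z
    using tendsto_inner[OF tendsto_const lim[OF Z]]
    by (rule tendsto_upperbound)
       (use le[OF Z] in \<open>auto simp: eventually_at_right_less eventually_at_filter\<close>)
  have NV: "commutator N V \<in> skew_hermitian"
    using N V by (rule commutator_skew)
  have inner_N: "inner N (commutator Z V) = inner Z (commutator V N)" if Z: "Z \<in> skew_hermitian" for Z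
    using inner_commutator_left[OF V, of Z N] commutator_flip[of V Z] commutator_flip
    by (simp add: inner_commute)
  \<comment> \<open>The first order condition is tested in the direction [V,N] itself.\<close>
  have "inner (commutator V N) (commutator V N) \<le> 0"
    using first[OF commutator_skew[OF V N]] inner_N[OF commutator_skew[OF V N]] by simp
  then have VN0: "commutator V N = 0"
    by (metis inner_eq_zero_iff inner_ge_zero order_antisym)
  then show "commutator N V = 0"
    by (simp add: commutator_flip[of N V])
  assume Z: "Z \<in> skew_hermitian"
  \<comment> \<open>As (N|[Z,V]) = 0, undoing the congruence and expanding writes -(N|C) as t times
    this expression; \<open>le\<close> then gives its sign. In the limit only the second order form
    is left.\<close>
  have ge: "0 \<le> inner (commutator Z N) (C Z t) - t * inner N (Z ** C Z t ** Z)" if t: "t > 0" for t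
  proof -
    have tZ: "t *\<^sub>R Z \<in> skew_hermitian"
      using Z by (rule skew_hermitian_scaleR)
    let ?A = "?A Z t" and ?C = "C Z t"
    have "commutator Z V = ((mat 1 - t *\<^sub>R Z) ** ?A) ** commutator Z V ** (conj_transpose ?A ** (mat 1 + t *\<^sub>R Z))"
      by (simp only: resolvent_right[OF tZ] conj_transpose_resolvent(2)[OF tZ]) simp
    also have "\<dots> = (mat 1 - t *\<^sub>R Z) ** ?C ** (mat 1 + t *\<^sub>R Z)"
      by (simp only: matrix_mul_assoc C_def)
    also have "\<dots> = ?C - t *\<^sub>R commutator Z ?C - t\<^sup>2 *\<^sub>R (Z ** ?C ** Z)"
      by (simp add: commutator_def matrix_mult_algebra power2_eq_square algebra_simps)
    finally have "inner N (commutator Z V)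
        = inner N ?C - t * inner N (commutator Z ?C) - t\<^sup>2 * inner N (Z ** ?C ** Z)"
      by (simp add: inner_diff_right)
    moreover have "inner N (commutator Z V) = 0"
      using inner_N[OF Z] VN0 by simp
    moreover have "inner N (commutator Z ?C) = - inner (commutator Z N) ?C"
      using inner_commutator_left[OF Z, of N ?C] by simp
    ultimately have "t * (inner (commutator Z N) ?C - t * inner N (Z ** ?C ** Z)) = - inner N ?C"
      by (simp add: power2_eq_square algebra_simps)
    then show ?thesis
      using le[OF Z t] t by (smt (verit) mult_neg_neg mult_pos_neg)
  qed
  have "((\<lambda>t. inner (commutator Z N) (C Z t) - t * inner N (Z ** C Z t ** Z))
      \<longlongrightarrow> inner (commutator Z N) (commutator Z V) - 0 * inner N (Z ** commutator Z V ** Z)) (at_right 0)"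
    by (intro tendsto_intros matrix_mult.tendsto lim[OF Z])
  then have "0 \<le> inner (commutator Z N) (commutator Z V) - 0 * inner N (Z ** commutator Z V ** Z)"
    by (rule tendsto_lowerbound) (use ge in \<open>auto simp: eventually_at_filter\<close>)
  then show "0 \<le> inner (commutator Z N) (commutator Z V)" by simp
qed

section \<open>Kernel of the semidefinite commutator form\<close>

lemma quadratic_nonneg_imp_linear_zero:
  fixes a g :: real
  assumes "0 \<le> g" and nonneg: "\<And>t. 0 \<le> 2 * t * a + t\<^sup>2 * g"
  shows "a = 0"
proof (rule ccontr)
  assume "a \<noteq> 0"
  \<comment> \<open>For g > 0 the minimiser is -a/g. The denominator g + 1 also covers g = 0, and
    the value at -s is still negative.\<close>
  define s where "s = a / (g + 1)"
  have s: "s * g = a - s" "s \<noteq> 0"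
    using \<open>a \<noteq> 0\<close> \<open>0 \<le> g\<close> by (simp_all add: s_def field_simps)
  have "2 * (- s) * a + (- s)\<^sup>2 * g = - (2 * s * a) + s * (s * g)"
    by (simp add: power2_eq_square)
  also have "\<dots> = - (s * a) - s * s"
    unfolding s(1) by (simp add: algebra_simps)
  also have "s * a = s * s * (g + 1)"
    using s(1) by (simp add: algebra_simps)
  finally have "0 \<le> - (s * s * (g + 1)) - s * s"
    using nonneg[of "- s"] by simp
  moreover have "0 < s * s"
    using s(2) by (metis not_real_square_gt_zero)
  moreover have "0 \<le> s * s * (g + 1)"
    using \<open>0 \<le> g\<close> by simp
  ultimately show False by linarith
qed

lemma inner_commutator_right:
  assumes "B \<in> skew_hermitian"
  shows "inner (commutator A B) C = inner A (commutator B C)"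
  using inner_commutator_left[OF assms, of A C] commutator_flip[of A B] by simp

text \<open>Both ad N and ad V are skew-adjoint, and they commute because \<open>N\<close> and
  \<open>V\<close> do.\<close>

lemma inner_commutator_swap:
  assumes N: "N \<in> skew_hermitian" and V: "V \<in> skew_hermitian" and comm: "N ** V = V ** N"
  shows "inner (commutator A N) (commutator B V) = inner (commutator B N) (commutator A V)"
proof -
  have "inner (commutator A N) (commutator B V) = inner A (commutator (commutator N B) V)"
    by (simp add: inner_commutator_right[OF N] commutator_commutator_commute[OF comm])
  also have "\<dots> = - inner (commutator A V) (commutator N B)"
    by (simp add: inner_commutator_right[OF V] commutator_flip[of "commutator N B" V])
  finally show ?thesis
    by (simp add: inner_commute commutator_flip[of B N])
qed

lemma semidefinite_kernel:
  fixes N V X :: "'n::finite cmat"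
  assumes psd: "\<And>Z. Z \<in> skew_hermitian \<Longrightarrow> 0 \<le> inner (commutator Z N) (commutator Z V)"
    and N: "N \<in> skew_hermitian" and V: "V \<in> skew_hermitian" and X: "X \<in> skew_hermitian"
    and comm: "N ** V = V ** N"
    and null: "inner (commutator X N) (commutator X V) = 0"
  shows "commutator N (commutator X V) = 0"
proof -
  \<comment> \<open>Perturb \<open>X\<close> to X + t W: by symmetry both mixed terms equal |W|^2,
    so nonnegativity for all t, with value 0 at t = 0, forces W = 0.\<close>
  define W where "W = commutator N (commutator X V)"
  have WX: "inner (commutator W N) (commutator X V) = inner W W"
    by (simp add: inner_commutator_right[OF N] W_def)
  then have XW: "inner (commutator X N) (commutator W V) = inner W W"
    by (simp add: inner_commutator_swap[OF N V comm, of X W])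
  have W: "W \<in> skew_hermitian"
    unfolding W_def using N V X by (intro commutator_skew)
  have "0 \<le> 2 * t * inner W W + t\<^sup>2 * inner (commutator W N) (commutator W V)" for t
    using psd[OF skew_hermitian_add[OF X skew_hermitian_scaleR[OF W]], of t]
    by (simp add: commutator_add_left commutator_scaleR_left inner_add_left inner_add_right
        null WX XW power2_eq_square algebra_simps)
  then have "inner W W = 0"
    using psd[OF W] by (rule quadratic_nonneg_imp_linear_zero[rotated])
  then show ?thesis by (simp add: W_def)
qed

section \<open>Spectral projections\<close>

locale spectral_data =
  fixes V :: "'n::finite cmat" and m v P
  assumes skew: "V \<in> skew_hermitian" and resolution: "spectral_resolution V m v P"
begin

abbreviation H where "H \<equiv> cscale (- \<i>) V"

lemma V_eq: "V = cscale \<i> (\<Sum>k\<in>{1..m}. v k *\<^sub>R P k)"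
  using resolution by (simp add: spectral_resolution_def)

lemma
  assumes "k \<in> {1..m}"
  shows P_idem: "P k ** P k = P k" and P_adj: "conj_transpose (P k) = P k"
    and P_range: "range (\<lambda>x. P k *v x) = {x. H *v x = v k *\<^sub>R x}"
  using resolution assms
  by (simp_all add: spectral_resolution_def orthogonal_projection_onto_def eigenspace_def
      of_real_scale_vec)

lemma H_P: "k \<in> {1..m} \<Longrightarrow> H *v (P k *v x) = v k *\<^sub>R (P k *v x)"
  using P_range by blast

lemma P_fix:
  assumes k: "k \<in> {1..m}" and "H *v x = v k *\<^sub>R x"
  shows "P k *v x = x"
proof -
  obtain y where "x = P k *v y"
    using assms P_range by blast
  then show ?thesis
    by (simp add: P_idem[OF k] matrix_vector_mul_assoc)
qed

text \<open>A matrix commuting with \<open>V\<close> maps each eigenspace of \<open>H\<close> into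
  itself.\<close>

lemma P_mult_fix:
  assumes k: "k \<in> {1..m}" and YV: "Y ** V = V ** Y"
  shows "P k ** Y ** P k = Y ** P k"
proof -
  have HY: "H ** Y = Y ** H"
    by (simp add: cscale_mult_left cscale_mult_right YV)
  have "P k *v (Y *v (P k *v x)) = Y *v (P k *v x)" for x
  proof (rule P_fix[OF k])
    have "H *v (Y *v (P k *v x)) = Y *v (H *v (P k *v x))"
      by (simp only: matrix_vector_mul_assoc matrix_mul_assoc HY)
    then show "H *v (Y *v (P k *v x)) = v k *\<^sub>R (Y *v (P k *v x))"
      by (simp add: H_P[OF k] matrix_vector_scaleR)
  qed
  then show ?thesis
    by (simp add: matrix_eq matrix_vector_mul_assoc matrix_mul_assoc)
qed

text \<open>As \<open>V\<close> is skew-Hermitian, the adjoint of \<open>Y\<close> commutes with it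
  too. By \<open>P_mult_fix\<close> for both, P Y P equals Y P and, after taking adjoints, P
  Y.\<close>

lemma P_commute:
  assumes k: "k \<in> {1..m}" and YV: "Y ** V = V ** Y"
  shows "Y ** P k = P k ** Y"
proof -
  have "conj_transpose Y ** V = V ** conj_transpose Y"
    using arg_cong[OF YV, of conj_transpose] skew
    by (simp add: conj_transpose_mult skew_hermitian_iff matrix_mult_algebra)
  then have "conj_transpose (P k ** conj_transpose Y ** P k) = conj_transpose (conj_transpose Y ** P k)"
    using P_mult_fix[OF k] by simp
  then show ?thesis
    using P_mult_fix[OF k YV] by (simp add: conj_transpose_mult P_adj[OF k] matrix_mul_assoc)
qed

lemma V_commute_P: "k \<in> {1..m} \<Longrightarrow> V ** P k = P k ** V"
  by (rule P_commute) simp_all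

text \<open>The two projections commute, so P j P k x lies in both eigenspaces, which belong to
  different eigenvalues.\<close>

lemma P_orth:
  assumes j: "j \<in> {1..m}" and k: "k \<in> {1..m}" and "j \<noteq> k"
  shows "P j ** P k = 0"
proof -
  have "P j *v (P k *v x) = 0" for x
  proof -
    let ?y = "P j *v (P k *v x)"
    have "P j ** P k = P k ** P j"
      using V_commute_P[OF j] by (intro P_commute[OF k]) simp
    then have "?y = P k *v (P j *v x)"
      by (simp add: matrix_vector_mul_assoc)
    then have "v j *\<^sub>R ?y = v k *\<^sub>R ?y"
      using H_P[OF j, of "P k *v x"] H_P[OF k, of "P j *v x"] by (simp only:)
    moreover have "v j \<noteq> v k"
      using resolution j k \<open>j \<noteq> k\<close> unfolding spectral_resolution_def
      by (metis less_irrefl linorder_neqE_nat)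
    ultimately show ?thesis by simp
  qed
  then show ?thesis
    by (simp add: matrix_eq matrix_vector_mul_assoc)
qed

lemma P_mult: "j \<in> {1..m} \<Longrightarrow> k \<in> {1..m} \<Longrightarrow> P j ** P k = (if j = k then P k else 0)"
  by (simp add: P_orth P_idem)

lemma H_eq: "H = (\<Sum>k\<in>{1..m}. v k *\<^sub>R P k)"
  by (subst V_eq) (simp add: vec_eq_iff cscale_nth)

text \<open>Completeness is hidden in the list of eigenvalues: the residual \<open>y\<close> is
  killed by every \<open>P k\<close>, hence by \<open>H\<close>. If nonzero, it would make 0 an
  eigenvalue, so some \<open>v k\<close> is 0 and that \<open>P k\<close> would fix
  \<open>y\<close>.\<close>

lemma sum_P: "(\<Sum>k\<in>{1..m}. P k) = mat 1"
proof -
  have "(\<Sum>k\<in>{1..m}. P k) *v x = x" for x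
  proof (rule ccontr)
    assume neq: "\<not> ?thesis"
    define y where "y = x - (\<Sum>k\<in>{1..m}. P k) *v x"
    have Py: "P k *v y = 0" if k: "k \<in> {1..m}" for k
    proof -
      have "P k ** (\<Sum>k\<in>{1..m}. P k) = (\<Sum>j\<in>{1..m}. if k = j then P j else 0)"
        unfolding matrix_mult.sum_right using k by (intro sum.cong) (auto simp: P_mult)
      also have "\<dots> = P k" using k by simp
      finally show ?thesis
        by (simp add: y_def matrix_vector_mult_diff_distrib matrix_vector_mul_assoc)
    qed
    have "H *v y = 0"
      unfolding H_eq by (simp add: sum_matrix_vector scaleR_matrix_vector Py)
    moreover have "y \<noteq> 0" using neq by (simp add: y_def)
    ultimately have "0 \<in> eigenvalues H"
      by (auto simp: eigenvalues_def)
    then obtain k where k: "k \<in> {1..m}" "v k = 0"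
      using resolution by (auto simp: spectral_resolution_def)
    then have "P k *v y = y"
      using \<open>H *v y = 0\<close> by (intro P_fix) auto
    then show False
      using Py[OF k(1)] \<open>y \<noteq> 0\<close> by simp
  qed
  then show ?thesis by (simp add: matrix_eq)
qed

lemma V_P:
  assumes "k \<in> {1..m}"
  shows "V ** P k = cscale \<i> (v k *\<^sub>R P k)"
proof -
  have "(\<Sum>j\<in>{1..m}. v j *\<^sub>R P j) ** P k = (\<Sum>j\<in>{1..m}. if j = k then v k *\<^sub>R P k else 0)"
    unfolding matrix_mult.sum_left
    using assms by (intro sum.cong) (auto simp: P_mult matrix_mult_algebra)
  also have "\<dots> = v k *\<^sub>R P k"
    using assms by simp
  finally show ?thesis
    by (subst V_eq) (simp add: cscale_mult_left)
qed

lemma P_nonzero: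
  assumes k: "k \<in> {1..m}"
  shows "P k \<noteq> 0"
proof -
  have "eigenvalues H = (\<lambda>k. complex_of_real (v k)) ` {1..m}"
    using resolution unfolding spectral_resolution_def by (elim conjE)
  then have "complex_of_real (v k) \<in> eigenvalues H"
    using k by blast
  then obtain x where "x \<noteq> 0" "H *v x = v k *\<^sub>R x"
    by (auto simp: eigenvalues_def of_real_scale_vec)
  then show ?thesis
    using P_fix[OF k] by force
qed

section \<open>Diagonal and codiagonal blocks\<close>

lemma block_decomposition:
  "X = (\<Sum>k\<in>{1..m}. P k ** X ** P k) + block_codiagonal m P X"
proof -
  have "X = (\<Sum>k\<in>{1..m}. P k) ** X ** (\<Sum>j\<in>{1..m}. P j)"
    unfolding sum_P by simp
  also have "\<dots> = (\<Sum>k\<in>{1..m}. \<Sum>j\<in>{1..m}. P k ** X ** P j)"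
    by (simp only: matrix_mult.sum_left matrix_mult.sum_right) (rule sum.swap)
  also have "\<dots> = (\<Sum>k\<in>{1..m}. P k ** X ** P k + (\<Sum>j\<in>{1..m} - {k}. P k ** X ** P j))"
    by (intro sum.cong refl sum.remove) auto
  finally show ?thesis
    by (simp add: sum.distrib block_codiagonal_def)
qed

lemma block_codiagonal_eq: "block_codiagonal m P X = X - (\<Sum>k\<in>{1..m}. P k ** X ** P k)"
  using block_decomposition[of X] by (metis add_diff_cancel_left')

lemma block_codiagonal_skew:
  assumes X: "X \<in> skew_hermitian"
  shows "block_codiagonal m P X \<in> skew_hermitian"
proof -
  have "P k ** X ** P k \<in> skew_hermitian" if "k \<in> {1..m}" for k
    using skew_hermitian_congruence[OF X, of "P k"] P_adj[OF that] by simp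
  then show ?thesis
    unfolding block_codiagonal_eq
    using X by (intro skew_hermitian_diff subspace_sum[OF subspace_skew_hermitian]) auto
qed

lemma diagonal_block_mult:
  assumes k: "k \<in> {1..m}"
  shows "P k ** (\<Sum>j\<in>{1..m}. P j ** X ** P j) = P k ** X ** P k"
    and "(\<Sum>j\<in>{1..m}. P j ** X ** P j) ** P k = P k ** X ** P k"
proof -
  have "P k ** (\<Sum>j\<in>{1..m}. P j ** X ** P j) = (\<Sum>j\<in>{1..m}. if k = j then P j ** X ** P j else 0)"
    unfolding matrix_mult.sum_right matrix_mul_assoc
    using k by (intro sum.cong) (auto simp: P_mult matrix_mult_algebra)
  then show "P k ** (\<Sum>j\<in>{1..m}. P j ** X ** P j) = P k ** X ** P k"
    using k by simp
  have "(\<Sum>j\<in>{1..m}. P j ** X ** P j) ** P k = (\<Sum>j\<in>{1..m}. if j = k then P j ** X ** P j else 0)"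
    unfolding matrix_mult.sum_left
    using k by (intro sum.cong) (auto simp: P_mult matrix_mult_algebra simp flip: matrix_mul_assoc)
  then show "(\<Sum>j\<in>{1..m}. P j ** X ** P j) ** P k = P k ** X ** P k"
    using k by simp
qed

lemma P_block_codiagonal_P:
  assumes k: "k \<in> {1..m}"
  shows "P k ** block_codiagonal m P X ** P k = 0"
proof -
  have "P k ** block_codiagonal m P X ** P k = P k ** X ** P k - (P k ** X ** P k) ** P k"
    by (simp only: block_codiagonal_eq matrix_mult.diff_left matrix_mult.diff_right
        diagonal_block_mult[OF k])
  then show ?thesis
    by (simp add: P_idem[OF k] flip: matrix_mul_assoc)
qed

lemma diagonal_block_commute:
  assumes "diagonal_wrt m P D"
  shows "(\<Sum>j\<in>{1..m}. P j ** X ** P j) ** D = D ** (\<Sum>j\<in>{1..m}. P j ** X ** P j)"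
proof -
  obtain d where D: "D = cscale \<i> (\<Sum>k\<in>{1..m}. d k *\<^sub>R P k)"
    using assms by (auto simp: diagonal_wrt_def)
  define S where "S = (\<Sum>j\<in>{1..m}. P j ** X ** P j)"
  have "S ** P k = P k ** S" if "k \<in> {1..m}" for k
    unfolding S_def by (simp only: diagonal_block_mult[OF that])
  then have "(\<Sum>k\<in>{1..m}. S ** (d k *\<^sub>R P k)) = (\<Sum>k\<in>{1..m}. (d k *\<^sub>R P k) ** S)"
    by (intro sum.cong) (simp_all add: matrix_mult_algebra)
  then show ?thesis
    unfolding D S_def[symmetric] cscale_mult_left cscale_mult_right
    by (simp add: matrix_mult.sum_left matrix_mult.sum_right)
qed

text \<open>The block-diagonal part of \<open>X\<close> commutes with \<open>D\<close> and drops
  out. Used for D = V and, in case (a), for D = N.\<close>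

lemma commutator_block_codiagonal:
  assumes "diagonal_wrt m P D"
  shows "commutator X D = commutator (block_codiagonal m P X) D"
  using diagonal_block_commute[OF assms, of X]
  by (simp add: block_codiagonal_eq commutator_def matrix_mult_algebra algebra_simps)

lemma diagonal_V: "diagonal_wrt m P V"
  using V_eq by (auto simp: diagonal_wrt_def)

lemma commutator_codiagonal_zero:
  assumes NV: "N ** V = V ** N"
    and zero: "commutator N (commutator X V) = 0"
  shows "commutator (block_codiagonal m P X) N = 0"
proof -
  let ?C = "block_codiagonal m P X"
  define Y where "Y = commutator N ?C"
  have "commutator Y V = 0"
    using zero unfolding commutator_block_codiagonal[OF diagonal_V, of X] Y_def
    by (simp add: commutator_commutator_commute[OF NV])
  then have YV: "Y ** V = V ** Y"
    by (simp add: commutator_eq_0_iff)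
  \<comment> \<open>Since \<open>Y\<close> commutes with \<open>V\<close>, Y P k is the diagonal
    block P k Y P k. As \<open>N\<close> commutes with \<open>P k\<close>, this block is the
    commutator of \<open>N\<close> with the diagonal block of \<open>?C\<close>, which
    vanishes.\<close>
  have PYP: "Y ** P k = 0" if k: "k \<in> {1..m}" for k
  proof -
    have N: "N ** P k = P k ** N"
      by (rule P_commute[OF k NV])
    have "P k ** N ** ?C ** P k = N ** (P k ** ?C ** P k)"
      by (simp add: N[symmetric] matrix_mul_assoc)
    moreover have "P k ** ?C ** N ** P k = (P k ** ?C ** P k) ** N"
      by (simp add: N flip: matrix_mul_assoc)
    ultimately have "P k ** Y ** P k = 0"
      by (simp add: Y_def commutator_def matrix_mult_algebra matrix_mul_assoc
          P_block_codiagonal_P[OF k])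
    then show ?thesis
      by (simp add: P_mult_fix[OF k YV])
  qed
  have "Y = Y ** (\<Sum>k\<in>{1..m}. P k)"
    unfolding sum_P by simp
  also have "\<dots> = 0"
    unfolding matrix_mult.sum_right by (simp add: PYP)
  finally show ?thesis
    by (simp add: Y_def commutator_flip[of ?C])
qed

text \<open>All P k A P k commute with \<open>V\<close>, so \<open>N\<close> commutes with the full
  matrix algebra on each eigenspace and is a scalar there.\<close>

lemma diagonal_if_commutes_with_centralizer:
  assumes N: "N \<in> skew_hermitian"
    and comm: "\<And>Z. Z \<in> skew_hermitian \<Longrightarrow> commutator Z V = 0 \<Longrightarrow> commutator Z N = 0"
  shows "diagonal_wrt m P N"
proof -
  have blocks: "N ** (P k ** A ** P k) = (P k ** A ** P k) ** N" if k: "k \<in> {1..m}" for k A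
  proof -
    have skew_case: "N ** (P k ** B ** P k) = (P k ** B ** P k) ** N" if B: "B \<in> skew_hermitian" for B
    proof -
      have "P k ** B ** P k \<in> skew_hermitian"
        using skew_hermitian_congruence[OF B, of "P k"] P_adj[OF k] by simp
      moreover have "commutator (P k ** B ** P k) V = 0"
      proof -
        have "P k ** B ** (P k ** V) = (V ** P k) ** B ** P k"
          by (simp add: V_commute_P[OF k, symmetric] V_P[OF k] cscale_mult_left cscale_mult_right matrix_mult_algebra)
        then show ?thesis
          by (simp add: commutator_def matrix_mul_assoc)
      qed
      ultimately show ?thesis
        using comm by (simp add: commutator_eq_0_iff)
    qed
    \<comment> \<open>The hypothesis \<open>comm\<close> reaches skew-Hermitian matrices only;
      complex linearity covers arbitrary \<open>A\<close>.\<close>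
    have A: "P k ** A ** P k = P k ** skew_part A ** P k
        + cscale \<i> (P k ** skew_part (cscale (- \<i>) A) ** P k)"
      by (subst skew_part_decomposition[of A])
         (simp add: matrix_mult_algebra cscale_mult_left cscale_mult_right)
    show ?thesis
      unfolding A by (simp add: matrix_mult_algebra cscale_mult_left cscale_mult_right skew_case skew_part_in)
  qed
  have NV: "N ** V = V ** N"
    using comm[OF skew] by (simp add: commutator_eq_0_iff)
  have "\<exists>d::real. N ** P k = cscale \<i> (d *\<^sub>R P k)" if k: "k \<in> {1..m}" for k
  proof -
    obtain b j where bj: "P k $ b $ j \<noteq> 0"
      using P_nonzero[OF k] by (auto simp: vec_eq_iff)
    define c where "c = (P k ** N) $ b $ j / P k $ b $ j"
    have NP: "N ** P k = cscale c (P k)"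
      unfolding vec_eq_iff cscale_nth
    proof (intro allI)
      fix i a :: 'n
      \<comment> \<open>A matrix unit: entry (i,j) of A E B is the product of A(i,a) and B(b,j).
        Commutation with P k E P k thus separates the indices and makes N P k proportional to
        \<open>P k\<close>, with ratio \<open>c\<close> read off at a nonzero entry.\<close>
      define E :: "'n cmat" where "E = (\<chi> p q. if p = a \<and> q = b then 1 else 0)"
      have E: "(A ** E ** B) $ i $ j = A $ i $ a * B $ b $ j" for A B :: "'n cmat"
      proof -
        have "(A ** E) $ i $ q = (if q = b then A $ i $ a else 0)" for q
          by (simp add: matrix_matrix_mult_def E_def if_distrib[of "(*) _"] cong: if_cong)
        then show ?thesis
          by (subst matrix_matrix_mult_def) (simp add: if_distrib[of "\<lambda>x. x * _"] cong: if_cong)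
      qed
      have "(N ** P k ** E ** P k) $ i $ j = (P k ** E ** (P k ** N)) $ i $ j"
        using blocks[OF k, of E] by (simp add: matrix_mul_assoc)
      then show "(N ** P k) $ i $ a = c * P k $ i $ a"
        unfolding E using bj by (simp add: c_def field_simps)
    qed
    \<comment> \<open>Taking adjoints in N P k = c P k shows that \<open>c\<close> is imaginary,
      because \<open>N\<close> is skew-Hermitian and commutes with \<open>P k\<close>.\<close>
    have "cscale (cnj c) (P k) = cscale (- c) (P k)"
      using arg_cong[OF NP, of conj_transpose] N P_commute[OF k NV] NP
      by (simp add: conj_transpose_mult conj_transpose_cscale P_adj[OF k] skew_hermitian_iff
          matrix_mult_algebra) (simp add: vec_eq_iff cscale_nth)
    then have "cnj c = - c"
      using bj by (metis cscale_nth mult_right_cancel)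
    then have c: "c = \<i> * complex_of_real (Im c)"
      by (simp add: complex_eq_iff)
    then have "cscale c (P k) = cscale \<i> (Im c *\<^sub>R P k)"
      by (subst c) (simp add: vec_eq_iff cscale_nth complex_eq_iff)
    then show ?thesis using NP by auto
  qed
  then obtain d where d: "\<And>k. k \<in> {1..m} \<Longrightarrow> N ** P k = cscale \<i> (d k *\<^sub>R P k)"
    by metis
  have "N = N ** (\<Sum>k\<in>{1..m}. P k)"
    unfolding sum_P by simp
  also have "\<dots> = (\<Sum>k\<in>{1..m}. cscale \<i> (d k *\<^sub>R P k))"
    unfolding matrix_mult.sum_right using d by (intro sum.cong) auto
  also have "\<dots> = cscale \<i> (\<Sum>k\<in>{1..m}. d k *\<^sub>R P k)"
    by (simp add: vec_eq_iff cscale_nth sum_distrib_left)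
  finally show ?thesis
    by (auto simp: diagonal_wrt_def)
qed

end

section \<open>Norming functionals\<close>

text \<open>Dividing by \<nu> Y > 0 moves \<open>Y\<close> into the unit ball, where \<phi> is at
  most 1. The norm is rescaled by a positive factor only, so positive homogeneity suffices.\<close>

lemma norming_functional_le:
  assumes \<nu>: "Ad_invariant_Finsler_norm \<nu>" and \<phi>: "norming_functional \<nu> V \<phi>"
    and Y: "Y \<in> skew_hermitian"
  shows "\<phi> Y \<le> \<nu> Y"
proof -
  have lin: "linear_functional \<phi>" and one: "functional_norm \<nu> \<phi> = 1"
    using \<phi> by (auto simp: norming_functional_def)
  have bound: "\<phi> Z \<le> 1" if "Z \<in> skew_hermitian" "\<nu> Z \<le> 1" for Z
    using functional_norm_attained[OF \<nu> lin] that one by auto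
  have scale: "\<nu> (r *\<^sub>R Y) = r * \<nu> Y" if "0 \<le> r" for r
    using \<nu> Y that by (auto simp: Ad_invariant_Finsler_norm_def)
  have \<phi>_scale: "\<phi> (r *\<^sub>R Y) = r * \<phi> Y" for r
    using lin Y by (auto simp: linear_functional_def)
  show ?thesis
  proof (cases "\<nu> Y = 0")
    case True
    then have "Y = 0"
      using \<nu> Y by (auto simp: Ad_invariant_Finsler_norm_def)
    then show ?thesis
      using \<phi>_scale[of 0] True by simp
  next
    case False
    then have "0 < \<nu> Y"
      using \<nu> Y by (force simp: Ad_invariant_Finsler_norm_def)
    then have "\<phi> (inverse (\<nu> Y) *\<^sub>R Y) \<le> 1"
      using Y by (intro bound skew_hermitian_scaleR) (auto simp: scale)
    then show ?thesis
      using \<open>0 < \<nu> Y\<close> by (simp add: \<phi>_scale field_simps)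
  qed
qed

lemma Ad_invariant:
  "Ad_invariant_Finsler_norm \<nu> \<Longrightarrow> X \<in> skew_hermitian \<Longrightarrow> U \<in> unitary_matrices
    \<Longrightarrow> \<nu> (U ** X ** conj_transpose U) = \<nu> X"
  by (simp add: Ad_invariant_Finsler_norm_def)

lemma inner_conj:
  "inner (U ** A ** conj_transpose U) B = inner A (conj_transpose U ** B ** U)"
  for A :: "'n::finite cmat"
  by (simp only: inner_mult_right[of "U ** A"] inner_mult_left[of U A] conj_transpose_conj_transpose matrix_mul_assoc)

lemma unitary_conj_transpose:
  "U \<in> unitary_matrices \<Longrightarrow> conj_transpose U \<in> unitary_matrices"
  by (simp add: unitary_matrices_def)

text \<open>Conjugating \<open>N\<close> by a unitary commuting with \<open>V\<close> gives another norming functional.\<close>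

lemma unique_norming_commutes:
  fixes N V :: "'n::finite cmat"
  assumes \<nu>: "Ad_invariant_Finsler_norm \<nu>"
    and N: "N \<in> skew_hermitian" and unique: "unique_norming_functional \<nu> V (inner N)"
    and Z: "Z \<in> skew_hermitian" and ZV: "commutator Z V = 0"
  shows "commutator Z N = 0"
proof -
  let ?U = "cayley Z" and ?N = "cayley Z ** N ** conj_transpose (cayley Z)"
  have U: "?U \<in> unitary_matrices" and U': "conj_transpose ?U \<in> unitary_matrices"
    using cayley_unitary[OF Z] unitary_conj_transpose by auto
  then have UU: "?U ** conj_transpose ?U = mat 1" "conj_transpose ?U ** ?U = mat 1"
    by (auto simp: unitary_matrices_def)
  have norming: "norming_functional \<nu> V (inner N)"
    using unique by (simp add: unique_norming_functional_def)
  have N': "?N \<in> skew_hermitian"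
    using N by (rule skew_hermitian_congruence)
  \<comment> \<open>Conjugation by \<open>?U\<close> maps the unit ball onto itself, so both
    functionals have the same values there and hence the same norm.\<close>
  have "inner ?N ` {Y \<in> skew_hermitian. \<nu> Y \<le> 1} = inner N ` {Y \<in> skew_hermitian. \<nu> Y \<le> 1}"
  proof (intro set_eqI iffI; elim imageE; clarify)
    fix Y assume Y: "Y \<in> skew_hermitian" "\<nu> Y \<le> 1"
    have "conj_transpose ?U ** Y ** ?U \<in> skew_hermitian" "\<nu> (conj_transpose ?U ** Y ** ?U) \<le> 1"
      using skew_hermitian_congruence[OF Y(1), of "conj_transpose ?U"] Ad_invariant[OF \<nu> Y(1) U'] Y(2)
      by auto
    then show "inner ?N Y \<in> inner N ` {Y \<in> skew_hermitian. \<nu> Y \<le> 1}"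
      by (auto simp: inner_conj)
    have "inner N Y = inner ?N (?U ** Y ** conj_transpose ?U)"
    proof -
      have "conj_transpose ?U ** (?U ** Y ** conj_transpose ?U) ** ?U
          = (conj_transpose ?U ** ?U) ** Y ** (conj_transpose ?U ** ?U)"
        by (simp only: matrix_mul_assoc)
      then show ?thesis by (simp add: inner_conj UU)
    qed
    then show "inner N Y \<in> inner ?N ` {Y \<in> skew_hermitian. \<nu> Y \<le> 1}"
      using skew_hermitian_congruence[OF Y(1), of ?U] Ad_invariant[OF \<nu> Y(1) U] Y(2) by auto
  qed
  then have "functional_norm \<nu> (inner ?N) = 1"
    using norming by (simp add: functional_norm_def norming_functional_def)
  moreover have "inner ?N V = inner N V"
  proof -
    have UV: "?U ** V ** conj_transpose ?U = V"
      using cayley_conj_eq_iff[OF Z] ZV by simp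
    have "conj_transpose ?U ** V ** ?U = (conj_transpose ?U ** ?U) ** V ** (conj_transpose ?U ** ?U)"
      by (subst UV[symmetric]) (simp only: matrix_mul_assoc)
    then show ?thesis by (simp add: inner_conj UU)
  qed
  ultimately have "norming_functional \<nu> V (inner ?N)"
    using norming by (simp add: norming_functional_def linear_functional_def inner_add_right)
  then have "inner ?N Y = inner N Y" if "Y \<in> skew_hermitian" for Y
    using unique that by (simp add: unique_norming_functional_def)
  then have "inner (?N - N) (?N - N) = 0"
    using skew_hermitian_diff[OF N' N] by (simp add: inner_diff_left)
  then have "?N = N" by simp
  then show ?thesis
    using cayley_conj_eq_iff[OF Z] by blast
qed

lemma commutator_zero_if_face_singleton:
  fixes N V :: "'n::finite cmat"
  assumes \<nu>: "Ad_invariant_Finsler_norm \<nu>" and V: "V \<in> skew_hermitian"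
    and norming: "norming_functional \<nu> V (inner N)"
    and face: "norming_face \<nu> V (inner N) = {V}"
    and Z: "Z \<in> skew_hermitian" and ZN: "commutator Z N = 0"
  shows "commutator Z V = 0"
proof -
  let ?U = "cayley Z"
  have U: "?U \<in> unitary_matrices"
    by (rule cayley_unitary[OF Z])
  \<comment> \<open>Since \<open>?U\<close> fixes \<open>N\<close>, it may be applied to both
    arguments and then cancelled.\<close>
  have "inner N (?U ** V ** conj_transpose ?U) = inner (?U ** V ** conj_transpose ?U) (?U ** N ** conj_transpose ?U)"
    using cayley_conj_eq_iff[OF Z, of N] ZN by (simp add: inner_commute)
  also have "\<dots> = inner V ((conj_transpose ?U ** ?U) ** N ** (conj_transpose ?U ** ?U))"
    by (simp only: inner_conj matrix_mul_assoc)
  also have "\<dots> = \<nu> V"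
    using U norming by (simp add: unitary_matrices_def inner_commute norming_functional_def)
  finally have "?U ** V ** conj_transpose ?U \<in> norming_face \<nu> V (inner N)"
    using Ad_invariant[OF \<nu> V U] skew_hermitian_congruence[OF V, of ?U]
    by (simp add: norming_face_def)
  then show ?thesis
    using cayley_conj_eq_iff[OF Z] face by auto
qed

theorem theorem2p35:
  fixes \<nu> :: "'n::finite cmat \<Rightarrow> real"
    and X V N :: "'n cmat"
    and m :: nat and v :: "nat \<Rightarrow> real" and P :: "nat \<Rightarrow> 'n cmat"
    and \<phi> :: "'n cmat \<Rightarrow> real"
  assumes "Ad_invariant_Finsler_norm \<nu>"
    and "X \<in> skew_hermitian" and "V \<in> skew_hermitian"
    and "spectral_resolution V m v P"
    and "N \<in> skew_hermitian" and "\<phi> = trace_inner N"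
    and "norming_functional \<nu> V \<phi>"
  shows "(\<phi> (commutator X (commutator X V)) = 0
            \<longleftrightarrow> commutator (block_codiagonal m P X) N = 0) \<and>
         (\<phi> (commutator X (commutator X V)) = 0 \<longrightarrow>
            (diagonal_wrt m P N \<longrightarrow> commutator X N = 0) \<and>
            (unique_norming_functional \<nu> V \<phi> \<longrightarrow> diagonal_wrt m P N \<and> commutator X N = 0) \<and>
            (norming_face \<nu> V \<phi> = {V} \<longrightarrow> commutator X V = 0))"
proof -
  note \<nu> = assms(1) and X = assms(2) and V = assms(3) and N = assms(5)
  have \<phi>: "\<phi> = inner N"
    using assms(6) by (auto simp: trace_inner_eq_inner)
  have norming: "norming_functional \<nu> V (inner N)"
    using assms(7) by (simp add: \<phi>)
  interpret spectral_data V m v P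
    using V assms(4) by unfold_locales
  let ?C = "block_codiagonal m P X"
  have C: "?C \<in> skew_hermitian"
    by (rule block_codiagonal_skew[OF X])
  have "inner N (U ** V ** conj_transpose U) \<le> inner N V" if U: "U \<in> unitary_matrices" for U
    using norming_functional_le[OF \<nu> norming skew_hermitian_congruence[OF V, of U]]
      Ad_invariant[OF \<nu> V U] norming by (simp add: norming_functional_def)
  note max = second_order_maximality[OF this N V]
  have NV: "N ** V = V ** N"
    using max(1) by (simp add: commutator_eq_0_iff)
  have XV: "commutator X V = commutator ?C V"
    by (rule commutator_block_codiagonal[OF diagonal_V])
  have eq: "\<phi> (commutator X (commutator X V)) = - inner (commutator X N) (commutator X V)"
    using inner_commutator_left[OF X, of N "commutator X V"] by (simp add: \<phi>)
  have iff: "\<phi> (commutator X (commutator X V)) = 0 \<longleftrightarrow> commutator ?C N = 0"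
  proof
    assume "\<phi> (commutator X (commutator X V)) = 0"
    then have "commutator N (commutator X V) = 0"
      using max(2) N V X NV eq by (intro semidefinite_kernel) auto
    then show "commutator ?C N = 0"
      by (rule commutator_codiagonal_zero[OF NV])
  next
    assume 0: "commutator ?C N = 0"
    \<comment> \<open>\<open>N\<close> need not be diagonal, so \<open>X\<close> cannot be replaced
      by \<open>?C\<close> in [X,N] directly. The replacement is valid next to \<open>V\<close>, and
      the symmetry of the form carries it over to \<open>N\<close>.\<close>
    have "inner (commutator X N) (commutator X V) = inner (commutator ?C N) (commutator X V)"
      using inner_commutator_swap[OF N V NV, of X ?C] by (simp add: XV)
    then show "\<phi> (commutator X (commutator X V)) = 0"
      by (simp add: eq 0)
  qed
  have a: "commutator X N = 0" if "commutator ?C N = 0" "diagonal_wrt m P N"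
    using commutator_block_codiagonal[OF that(2)] that(1) by simp
  have u: "diagonal_wrt m P N" if "unique_norming_functional \<nu> V \<phi>"
    using that unique_norming_commutes[OF \<nu> N] N
    by (intro diagonal_if_commutes_with_centralizer) (auto simp: \<phi>)
  \<comment> \<open>The face argument runs with \<open>?C\<close>, since \<open>X\<close> itself
    need not commute with \<open>N\<close>; this is enough because [X,V] = [?C,V].\<close>
  have b: "commutator X V = 0" if "commutator ?C N = 0" "norming_face \<nu> V \<phi> = {V}"
    using commutator_zero_if_face_singleton[OF \<nu> V norming _ C that(1)] that(2)
    by (simp add: XV \<phi>)
  show ?thesis
    using iff a u b by blast
qed

end
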